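(* Let $K$ and $L$ be compact lines, let $\phi:K\to L$ be a continuous increasing surjection, and let $(F_i)_{i\in I}$ be a weak*-null family in $\mathrm{NBV}(L)$. Then $(F_i)_{i\in I}$ extends through $\phi$ if and only if $(F_i)_{i\in I}$ is of type $c_0\ell_1$ over $Q(\phi)$. Moreover, if $(k_i)_{i\in I}$ is a bounded family of nonnegative real numbers and $(F_i)_{i\in I}$ is of type $c_0\ell_1$ over $Q(\phi)$ bounded by $(k_i)_{i\in I}$, then a weak*-null family $(G_i)_{i\in I}$ in $\mathrm{NBV}(K)$ with $\phi_*(G_i)=F_i$ for all $i\in I$ can be chosen with $\Vert G_i\Vert_{\mathrm{BV}}\le\Vert F_i\Vert_{\mathrm{BV}}+2k_i$ for all $i\in I$.
   Context: A compact line is a totally ordered set which is compact (Hausdorff) in its order topology. For a compact line $K$ and $F:K\to\mathbb R$, the total variation $V(F)$ is the supremum over finite sets $t_0<t_1<\dots<t_n$ in $K$ of $\sum_{j=0}^{n-1}|F(t_{j+1})-F(t_j)|$, and $\Vert F\Vert_{\mathrm{BV}}=|F(\min K)|+V(F)$; $\mathrm{NBV}(K)$ is the Banach space of right-continuous $F:K\to\mathbb R$ with $V(F)<\infty$. Each finite signed regular Borel measure $\mu$ on $K$ corresponds to $F_\mu(t)=\mu([\min K,t])$, giving a linear isometric identification of $M(K)=C(K)^*$ with $\mathrm{NBV}(K)$; for $F\in\mathrm{NBV}(K)$, "the measure associated to $F$" is the $\mu$ with $F_\mu=F$. For a family $(a_i)_{i\in I}$ of reals, $\lim_{i\in I}a_i=0$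 means $\{i\in I:|a_i|\ge\varepsilon\}$ is finite for every $\varepsilon>0$; $c_0(I)$ is the space of such families. A family $(F_i)_{i\in I}$ in $\mathrm{NBV}(K)$ is weak*-null if $\lim_{i\in I}\int_K f\,d\mu_i=0$ for every $f\in C(K)$, where $\mu_i$ is the measure associated to $F_i$. For a continuous increasing surjection $\phi:K\to L$ between compact lines and any $G:K\to\mathbb R$, define $\phi_*(G):L\to\mathbb R$ by $\phi_*(G)(t)=G(\max\phi^{-1}(t))$; set $Q(\phi)=\{t\in L:\phi^{-1}(t)\text{ has more than one point}\}$. A weak*-null family $(F_i)_{i\in I}$ in $\mathrm{NBV}(L)$ extends through $\phi$ if there is a weak*-null family $(G_i)_{i\in I}$ in $\mathrm{NBV}(K)$ with $\phi_*(G_i)=F_i$ for all $i$ (equivalently, the associated bounded operator $C(L)\to c_0(I)$ has a bounded extension $S:C(K)\to c_0(I)$ with $S(f\circ\phi)=T(f)$). A family $(F_i)_{i\in I}$ of real-valued maps on a set $Q$ is of type $c_0\ell_1$ if one can write $F_i(t)=a_{i,t}+b_{i,t}$ ($i\in I,t\in Q$) with $\lim_{i\in I}a_{i,t}=0$ for every $t\in Q$ and $\sup_{i\in I}\sum_{t\in Q}|b_{i,t}|<\infty$; it is of type $c_0\ell_1$ bounded by a bounded family $(k_i)_{i\in I}$ of nonnegative reals if moreover $\sum_{t\in Q}|b_{i,t}|\le k_i$ for all $i$. A family of maps defined on a larger set is said to have such a property over a subset $S$ if the family of restrictions to $S$ has it. *)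

theory Defs
  imports "HOL-Analysis.Analysis"
begin

definition compact_line :: "'a::linorder_topology itself \<Rightarrow> bool" where
  "compact_line _ \<longleftrightarrow> compact (UNIV :: 'a set)"

definition fam_lim0 :: "('i \<Rightarrow> real) \<Rightarrow> bool" where
  "fam_lim0 a \<longleftrightarrow> (\<forall>\<epsilon>>0. finite {i. \<bar>a i\<bar> \<ge> \<epsilon>})"

definition var_sums :: "('a::linorder \<Rightarrow> real) \<Rightarrow> real set" where
  "var_sums F = (\<lambda>xs. \<Sum>j < length xs - 1. \<bar>F (xs ! Suc j) - F (xs ! j)\<bar>) ` {xs. sorted_wrt (<) xs}"

definition total_variation :: "('a::linorder \<Rightarrow> real) \<Rightarrow> real" where
  "total_variation F = Sup (var_sums F)"

definition bounded_variation :: "('a::linorder \<Rightarrow> real) \<Rightarrow> bool" where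
  "bounded_variation F \<longleftrightarrow> bdd_above (var_sums F)"

definition line_min :: "'a::linorder" where
  "line_min = (THE m. \<forall>x. m \<le> x)"

definition bv_norm :: "('a::linorder \<Rightarrow> real) \<Rightarrow> real" where
  "bv_norm F = \<bar>F line_min\<bar> + total_variation F"

definition NBV :: "('a::linorder_topology \<Rightarrow> real) set" where
  "NBV = {F. (\<forall>t. (F \<longlongrightarrow> F t) (at_right t)) \<and> bounded_variation F}"

text \<open>Finite regular Borel (nonnegative) measures; a finite signed regular Borel measure is
  represented as a difference M1 - M2 of two such measures.\<close>
definition regular_finite_borel :: "'a::topological_space measure \<Rightarrow> bool" where
  "regular_finite_borel M \<longleftrightarrow> sets M = sets borel \<and> finite_measure M \<and>
     (\<forall>A \<in> sets borel.
        measure M A = (INF U \<in> {U. open U \<and> A \<subseteq> U}. measure M U) \<and>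
        measure M A = (SUP C \<in> {C. compact C \<and> C \<subseteq> A}. measure M C))"

definition associated_measure ::
  "('a::linorder_topology \<Rightarrow> real) \<Rightarrow> 'a measure \<Rightarrow> 'a measure \<Rightarrow> bool" where
  "associated_measure F M1 M2 \<longleftrightarrow> regular_finite_borel M1 \<and> regular_finite_borel M2 \<and>
     (\<forall>t. measure M1 {line_min..t} - measure M2 {line_min..t} = F t)"

definition weak_star_null_NBV :: "('i \<Rightarrow> 'a::linorder_topology \<Rightarrow> real) \<Rightarrow> bool" where
  "weak_star_null_NBV F \<longleftrightarrow> (\<forall>i. F i \<in> NBV) \<and>
     (\<exists>M1 M2 :: 'i \<Rightarrow> 'a measure. (\<forall>i. associated_measure (F i) (M1 i) (M2 i)) \<and>
        (\<forall>f :: 'a \<Rightarrow> real. continuous_on UNIV f \<longrightarrow>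
           fam_lim0 (\<lambda>i. integral\<^sup>L (M1 i) f - integral\<^sup>L (M2 i) f)))"

definition phi_star :: "('k::linorder \<Rightarrow> 'l) \<Rightarrow> ('k \<Rightarrow> real) \<Rightarrow> 'l \<Rightarrow> real" where
  "phi_star \<phi> G t = G (GREATEST x. \<phi> x = t)"

definition Qset :: "('k \<Rightarrow> 'l) \<Rightarrow> 'l set" where
  "Qset \<phi> = {t. \<exists>x y. x \<noteq> y \<and> \<phi> x = t \<and> \<phi> y = t}"

definition extends_through :: "('k::linorder_topology \<Rightarrow> 'l) \<Rightarrow> ('i \<Rightarrow> 'l \<Rightarrow> real) \<Rightarrow> bool" where
  "extends_through \<phi> F \<longleftrightarrow> (\<exists>G :: 'i \<Rightarrow> 'k \<Rightarrow> real. weak_star_null_NBV G \<and> (\<forall>i. phi_star \<phi> (G i) = F i))"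

definition c0l1_bounded_over :: "'a set \<Rightarrow> ('i \<Rightarrow> 'a \<Rightarrow> real) \<Rightarrow> ('i \<Rightarrow> real) \<Rightarrow> bool" where
  "c0l1_bounded_over S F k \<longleftrightarrow> (\<exists>a b :: 'i \<Rightarrow> 'a \<Rightarrow> real.
     (\<forall>i. \<forall>t\<in>S. F i t = a i t + b i t) \<and>
     (\<forall>t\<in>S. fam_lim0 (\<lambda>i. a i t)) \<and>
     (\<forall>i. (\<lambda>t. \<bar>b i t\<bar>) summable_on S \<and> (\<Sum>\<^sub>\<infinity>t\<in>S. \<bar>b i t\<bar>) \<le> k i))"

definition c0l1_over :: "'a set \<Rightarrow> ('i \<Rightarrow> 'a \<Rightarrow> real) \<Rightarrow> bool" where
  "c0l1_over S F \<longleftrightarrow> (\<exists>C::real. c0l1_bounded_over S F (\<lambda>_. C))"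

end

theory Submission
  imports Defs
begin

text \<open>
  For t in Q(\<phi>) let [u, v] be the fibre of t.

  If G extends F through \<phi>, let f be continuous, equal to 1 up to u and to 0 from v on. Then
  a = \<integral> f dG tends to 0, and b = F(t) - a is the integral of 1_{x \<le> v} - f, which lives on (u, v].
  These intervals are disjoint, so the sum of the absolute values of the b's is bounded by the norm of G.
  The norms are bounded by the Banach-Steinhaus theorem.

  Conversely, given F = a + b on Q(\<phi>), put G = F \<circ> \<phi> - (sum over t of b_t 1_{[u, v)}).
  Then G = a on [u, v). Its integral against a function of the form g \<circ> \<phi> is that of g against F, and
  its integral against a function that varies only on [u, v] is a combination of a_t and of
  G(max). By Stone-Weierstrass the functions that are nonconstant on only finitely many fibres are dense,
  and the norms of the G's are bounded.

  Everything about integrals goes through Riemann sums in the distribution function. The measures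
  of G are obtained by writing G as a difference of increasing right-continuous functions.
\<close>

section \<open>Banach-Steinhaus and families tending to 0\<close>

text \<open>A pair of regular measures stands for a signed measure, and the pair is not tied to a
  Jordan decomposition. Nothing may therefore depend on more than the difference of the two
  distribution functions. Rays need not generate the Borel sets of a nonseparable compact line, so a
  \<pi>-system argument does not give this. Riemann sums do, because a continuous function is nearly
  constant on each of finitely many blocks. Regularity enters where the variation has to be
  recovered from continuous test functions, and where distribution functions must be
  right-continuous at points that are not limits of sequences from the right. The interval [u, v)
  contains u because G has to be right-continuous, and leaves out v because G(v) = F(t) is
  prescribed. Subtracting b_t on it costs a jump of -b_t at u and one of b_t at v; this is the 2 in
  2 k_i.\<close>

lemma complete_UNIV_bcontfun: "complete (UNIV :: ('a::topological_space \<Rightarrow>\<^sub>C 'b::complete_space) set)"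
  unfolding complete_def
proof (intro allI impI)
  fix f :: "nat \<Rightarrow> 'a \<Rightarrow>\<^sub>C 'b"
  assume "(\<forall>n. f n \<in> UNIV) \<and> Cauchy f"
  then obtain g where "uniform_limit UNIV f g sequentially"
    using uniformly_convergent_eq_cauchy[of "\<lambda>_. True" f]
    unfolding Cauchy_def uniform_limit_sequentially_iff
    by (metis dist_fun_lt_imp_dist_val_lt)
  then show "\<exists>l\<in>UNIV. f \<longlonglongrightarrow> l"
    by (metis UNIV_I sequentially_bot uniform_limit_bcontfunE)
qed

text \<open>The closed sets \<open>A n\<close> cover the space, so by Baire one of them contains a
  ball. Completeness is a hypothesis on \<open>UNIV\<close> so that the result applies to the
  bounded continuous functions on a compact line, whose domain carries no metric.\<close>

lemma banach_steinhaus_real: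
  fixes T :: "'i \<Rightarrow> 'b::real_normed_vector \<Rightarrow> real"
  assumes complete: "complete (UNIV :: 'b set)"
    and lin: "\<And>i. bounded_linear (T i)"
    and bdd: "\<And>x. \<exists>C. \<forall>i. \<bar>T i x\<bar> \<le> C"
  shows "\<exists>C. \<forall>i x. \<bar>T i x\<bar> \<le> C * norm x"
proof -
  define A where "A n = {x. \<forall>i. \<bar>T i x\<bar> \<le> real n}" for n :: nat
  have cl: "closed (A n)" for n
    unfolding A_def
    by (intro closed_Collect_all closed_Collect_le continuous_intros
        linear_continuous_on lin)
  have union: "(\<Union>n. A n) = UNIV"
  proof -
    have "x \<in> (\<Union>n. A n)" for x
    proof -
      obtain C where "\<forall>i. \<bar>T i x\<bar> \<le> C" using bdd by blast
      moreover obtain n :: nat where "C \<le> real n" using real_arch_simple by blast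
      ultimately show ?thesis unfolding A_def by (auto intro: order_trans)
    qed
    then show ?thesis by auto
  qed
  have "\<exists>n. interior (A n) \<noteq> {}"
  proof (rule ccontr)
    assume "\<not> ?thesis"
    then have "Met_TC.mtopology interior_of \<Union>(range A) = {}"
      by (intro Met_TC.metric_Baire_category_alt)
        (auto simp: cl interior_of_eq_empty_alt interior_def complete
          mcomplete_iff_complete interior_of_def)
    then show False unfolding union interior_of_def by (simp add: set_eq_iff) (metis UNIV_I open_UNIV)
  qed
  then obtain n x where "x \<in> interior (A n)" by auto
  then obtain r where r: "r > 0" "ball x r \<subseteq> A n"
    by (meson mem_interior)
  have "\<bar>T i y\<bar> \<le> (4 * real n / r) * norm y" for i y
  proof (cases "y = 0")
    case True
    then show ?thesis using bounded_linear.linear[OF lin] by (simp add: linear_0)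
  next
    case False
    interpret bounded_linear "T i" by (rule lin)
    \<comment> \<open>\<open>z\<close> has norm \<open>r / 2\<close>, so \<open>x\<close> and
      \<open>x + z\<close> both lie in the ball. Subtracting bounds \<open>T i z\<close> by
      \<open>2 n\<close>, and rescaling gives the factor \<open>4 n / r\<close>.\<close>
    define z where "z = (r / (2 * norm y)) *\<^sub>R y"
    have "norm z < r" using False r by (simp add: z_def)
    then have "x + z \<in> A n" "x \<in> A n" using r by (auto simp: subset_eq dist_norm)
    then have "\<bar>T i (x + z)\<bar> \<le> n" "\<bar>T i x\<bar> \<le> n" by (auto simp: A_def)
    then have "\<bar>T i z\<bar> \<le> 2 * real n" by (simp add: add)
    moreover have "T i z = (r / (2 * norm y)) * T i y" by (simp add: z_def scaleR)
    ultimately show ?thesis using False r by (simp add: abs_mult field_simps)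
  qed
  then show ?thesis by blast
qed

lemma fam_lim0_bounded: "fam_lim0 a \<Longrightarrow> \<exists>C. \<forall>i. \<bar>a i\<bar> \<le> C"
proof -
  assume "fam_lim0 a"
  then have fin: "finite {i. \<bar>a i\<bar> \<ge> 1}" by (simp add: fam_lim0_def)
  have "\<bar>a i\<bar> \<le> 1 + (\<Sum>j\<in>{i. \<bar>a i\<bar> \<ge> 1}. \<bar>a j\<bar>)" for i
  proof (cases "\<bar>a i\<bar> \<ge> 1")
    case True
    then have "\<bar>a i\<bar> \<le> (\<Sum>j\<in>{i. \<bar>a i\<bar> \<ge> 1}. \<bar>a j\<bar>)"
      by (intro member_le_sum[where f="\<lambda>j. \<bar>a j\<bar>"] fin) auto
    then show ?thesis by simp
  next
    case False
    then show ?thesis by (smt (verit) sum_nonneg abs_ge_zero)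
  qed
  then show ?thesis by blast
qed

lemma fam_lim0_lincomb:
  assumes "fam_lim0 a" "fam_lim0 b"
  shows "fam_lim0 (\<lambda>i. c * a i + d * b i)"
  unfolding fam_lim0_def
proof (intro allI impI)
  fix e :: real assume e: "e > 0"
  \<comment> \<open>The summand 1 keeps \<open>D\<close> positive when \<open>c\<close> and
    \<open>d\<close> vanish, and makes the estimate below strict.\<close>
  define D where "D = \<bar>c\<bar> + \<bar>d\<bar> + 1"
  have D: "D > 0" by (simp add: D_def add_nonneg_pos)
  have "finite ({i. \<bar>a i\<bar> \<ge> e / D} \<union> {i. \<bar>b i\<bar> \<ge> e / D})"
    using assms e D by (simp add: fam_lim0_def)
  moreover have "{i. \<bar>c * a i + d * b i\<bar> \<ge> e} \<subseteq> {i. \<bar>a i\<bar> \<ge> e / D} \<union> {i. \<bar>b i\<bar> \<ge> e / D}"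
  proof (rule subsetI, rule ccontr)
    fix i assume i: "i \<in> {i. \<bar>c * a i + d * b i\<bar> \<ge> e}"
      and n: "i \<notin> {i. \<bar>a i\<bar> \<ge> e / D} \<union> {i. \<bar>b i\<bar> \<ge> e / D}"
    then have "\<bar>a i\<bar> \<le> e / D" "\<bar>b i\<bar> \<le> e / D" by auto
    then have "\<bar>c * a i\<bar> \<le> \<bar>c\<bar> * (e / D)" "\<bar>d * b i\<bar> \<le> \<bar>d\<bar> * (e / D)"
      unfolding abs_mult by (auto intro: mult_left_mono simp del: times_divide_eq_right)
    then have "\<bar>c * a i + d * b i\<bar> \<le> (D - 1) * (e / D)" unfolding D_def distrib_right by (simp add: distrib_right del: times_divide_eq_right) linarith
    also have "\<dots> < D * (e / D)" using e D by (intro mult_strict_right_mono) auto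
    also have "\<dots> = e" using D by simp
    finally show False using i by simp
  qed
  ultimately show "finite {i. \<bar>c * a i + d * b i\<bar> \<ge> e}" by (rule finite_subset[rotated])
qed

lemma compact_t2_normal_space:
  assumes "compact (UNIV :: 'a::t2_space set)"
  shows "normal_space (euclidean :: 'a topology)"
proof (rule compact_Hausdorff_or_regular_imp_normal_space)
  show "compact_space (euclidean :: 'a topology)" using assms by (simp add: compact_space_def)
  show "Hausdorff_space (euclidean :: 'a topology) \<or> regular_space (euclidean :: 'a topology)"
    unfolding Hausdorff_space_def disjnt_def using hausdorff by (auto simp: open_openin[symmetric])
qed

section \<open>Continuous functions on compact lines\<close>

lemma line_min_eqI: "(\<And>y::'a::linorder. x \<le> y) \<Longrightarrow> line_min = x"
  unfolding line_min_def by (rule the_equality) (auto intro: antisym)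

lemma line_min_le:
  assumes "compact (UNIV :: 'a::linorder_topology set)"
  shows "line_min \<le> (x::'a)"
proof -
  obtain m :: 'a where "\<And>y. m \<le> y" using compact_attains_inf[OF assms] by auto
  then show ?thesis using line_min_eqI[of m] by simp
qed

lemma ex_line_max:
  assumes "compact (UNIV :: 'a::linorder_topology set)"
  shows "\<exists>m::'a. \<forall>y. y \<le> m"
  using compact_attains_sup[OF assms] by auto

text \<open>Urysohn's lemma for two disjoint closed rays. If nothing lies between \<open>x\<close>
  and \<open>z\<close>, the cutoff is a jump, continuous because both rays are then open.\<close>

lemma continuous_cutoff_between:
  fixes x z :: "'a::linorder_topology"
  assumes K: "compact (UNIV :: 'a set)" and "x < z"
  shows "\<exists>f::'a \<Rightarrow> real. continuous_on UNIV f \<and> (\<forall>y. 0 \<le> f y \<and> f y \<le> 1) \<and>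
    (\<forall>y\<le>x. f y = 1) \<and> (\<forall>y\<ge>z. f y = 0)"
proof -
  obtain f where f: "continuous_map euclidean (top_of_set {0..1::real}) f" "f ` {z..} \<subseteq> {0}" "f ` {..x} \<subseteq> {1}"
  proof (rule Urysohn_lemma[OF compact_t2_normal_space[OF K], of "{z..}" "{..x}" 0 1])
    show "disjnt {z..} {..x}" using \<open>x < z\<close> by (auto simp: disjnt_def)
  qed auto
  then show ?thesis
    by (intro exI[of _ f]) (auto simp: continuous_map_in_subtopology image_subset_iff)
qed

section \<open>Uniform approximation by step functions on half-open blocks\<close>

text \<open>For \<open>x < y\<close>, the point \<open>y\<close> may belong to \<open>T\<close>
  while \<open>x\<close> may not, so \<open>h\<close> varies by at most \<open>\<epsilon>\<close> on
  each block (s, t] between neighbouring points of \<open>T\<close>. These blocks are the sets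
  measured by increments of a distribution function, and indicators of closed left rays fit them
  exactly.\<close>

definition step_approximable :: "('a::linorder \<Rightarrow> real) \<Rightarrow> bool" where
  "step_approximable h \<longleftrightarrow> (\<forall>\<epsilon>>0. \<exists>T. finite T \<and>
     (\<forall>x y. x \<le> y \<and> {x..<y} \<inter> T = {} \<longrightarrow> \<bar>h x - h y\<bar> \<le> \<epsilon>))"

text \<open>By compactness finitely many neighbourhoods \<open>V z\<close> suffice. To the left of
  \<open>z\<close> a single marked point \<open>a\<close> gives control: if \<open>y\<close> lies
  beyond \<open>a\<close> and \<open>{x..<y}\<close> misses \<open>a\<close>, then \<open>x\<close>
  lies beyond \<open>a\<close> as well.\<close>

lemma step_approximable_continuous:
  fixes f :: "'a::linorder_topology \<Rightarrow> real"
  assumes K: "compact (UNIV :: 'a set)" and f: "continuous_on UNIV f"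
  shows "step_approximable f"
  unfolding step_approximable_def
proof (intro allI impI)
  fix e :: real assume e: "e > 0"
  define U where "U z = {y. \<bar>f y - f z\<bar> < e / 2}" for z
  have oU: "open (U z)" and zU: "z \<in> U z" for z
    using e unfolding U_def by (auto intro!: open_Collect_less continuous_intros f)
  have *: "\<exists>V T. open V \<and> z \<in> V \<and> finite T \<and> (\<forall>x y. x \<le> y \<and> y \<in> V \<and> {x..<y} \<inter> T = {} \<longrightarrow> x \<in> U z \<and> y \<in> U z)" for z
  proof (cases "\<exists>a. a < z")
    case True
    then obtain a where "a < z" "{a<..z} \<subseteq> U z" using open_left[OF oU zU] by blast
    moreover have "\<exists>V. open V \<and> z \<in> V \<and> V \<inter> {z..} \<subseteq> U z \<and> V \<subseteq> {a<..} \<and> (\<forall>x y. z \<le> x \<and> x \<le> y \<and> y \<in> V \<longrightarrow> x \<in> V)"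
    proof (cases "\<exists>b. z < b")
      case True
      then obtain b where "z < b" "{z..<b} \<subseteq> U z" using open_right[OF oU zU] by blast
      then show ?thesis using \<open>a < z\<close> by (intro exI[of _ "{a<..<b}"]) (auto simp: subset_eq)
    next
      case False
      then show ?thesis using \<open>a < z\<close> zU by (intro exI[of _ "{a<..}"]) (auto simp: not_less dest: antisym)
    qed
    then obtain V where V: "open V" "z \<in> V" "V \<inter> {z..} \<subseteq> U z" "V \<subseteq> {a<..}"
      "\<And>x y. z \<le> x \<Longrightarrow> x \<le> y \<Longrightarrow> y \<in> V \<Longrightarrow> x \<in> V" by blast
    moreover have "x \<in> U z \<and> y \<in> U z" if "x \<le> y" "y \<in> V" "{x..<y} \<inter> {a} = {}" for x y
    proof -
      have "a < y" using V that by auto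
      then have "a < x" using that by auto
      have "w \<in> U z" if "w = x \<or> w = y" for w
      proof (cases "w \<le> z")
        case True
        then show ?thesis using \<open>{a<..z} \<subseteq> U z\<close> that \<open>a < y\<close> \<open>a < x\<close> by auto
      next
        case False
        then have "w \<in> V" using V(5)[of w y] that \<open>x \<le> y\<close> \<open>y \<in> V\<close> by auto
        then show ?thesis using V(3) False by auto
      qed
      then show ?thesis by blast
    qed
    ultimately show ?thesis by (intro exI[of _ V] exI[of _ "{a}"]) auto
  next
    \<comment> \<open>\<open>z\<close> is the least element, so no point has to be marked.\<close>
    case False
    have *: "\<exists>V. open V \<and> z \<in> V \<and> V \<subseteq> U z \<and> (\<forall>x y. x \<le> y \<and> y \<in> V \<longrightarrow> x \<in> V)"
    proof (cases "\<exists>b. z < b")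
      case True
      then obtain b where "z < b" "{z..<b} \<subseteq> U z" using open_right[OF oU zU] by blast
      then show ?thesis using False by (intro exI[of _ "{..<b}"]) (auto simp: subset_eq not_less)
    next
      case F2: False
      have "y = z" for y using False F2 by (metis linorder_less_linear)
      then show ?thesis using zU by (intro exI[of _ UNIV]) (metis UNIV_I open_UNIV subsetI)
    qed
    then obtain V where "open V" "z \<in> V" "V \<subseteq> U z" "\<And>x y. x \<le> y \<Longrightarrow> y \<in> V \<Longrightarrow> x \<in> V"
      by blast
    then show ?thesis
      by - (rule exI[of _ V], rule exI[of _ "{}"], simp add: subset_eq, blast)
  qed
  have "\<exists>V. \<forall>z. \<exists>T. open (V z) \<and> z \<in> V z \<and> finite T \<and>
      (\<forall>x y. x \<le> y \<and> y \<in> V z \<and> {x..<y} \<inter> T = {} \<longrightarrow> x \<in> U z \<and> y \<in> U z)"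
    by (rule choice, rule allI, rule *)
  then obtain V where V0: "\<forall>z. \<exists>T. open (V z) \<and> z \<in> V z \<and> finite T \<and>
      (\<forall>x y. x \<le> y \<and> y \<in> V z \<and> {x..<y} \<inter> T = {} \<longrightarrow> x \<in> U z \<and> y \<in> U z)" ..
  obtain T where T: "\<forall>z. open (V z) \<and> z \<in> V z \<and> finite (T z) \<and>
      (\<forall>x y. x \<le> y \<and> y \<in> V z \<and> {x..<y} \<inter> T z = {} \<longrightarrow> x \<in> U z \<and> y \<in> U z)"
    using choice[OF V0] ..
  then have V: "\<And>z. open (V z)" "\<And>z. z \<in> V z" "\<And>z. finite (T z)"
    "\<And>z x y. x \<le> y \<Longrightarrow> y \<in> V z \<Longrightarrow> {x..<y} \<inter> T z = {} \<Longrightarrow> x \<in> U z \<and> y \<in> U z"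
    by simp_all
  obtain Z where Z: "finite Z" "UNIV = (\<Union>z\<in>Z. V z)"
    using compactE_image[OF K, of UNIV V] V by (metis UNIV_I UN_I subset_antisym subset_UNIV subsetI)
  show "\<exists>T. finite T \<and> (\<forall>x y. x \<le> y \<and> {x..<y} \<inter> T = {} \<longrightarrow> \<bar>f x - f y\<bar> \<le> e)"
  proof (intro exI[of _ "\<Union>z\<in>Z. T z"] conjI allI impI)
    show "finite (\<Union>z\<in>Z. T z)" using Z V by auto
    fix x y assume xy: "x \<le> y \<and> {x..<y} \<inter> (\<Union>z\<in>Z. T z) = {}"
    obtain z where "z \<in> Z" "y \<in> V z" using Z by auto
    moreover have "{x..<y} \<inter> T z = {}" using xy \<open>z \<in> Z\<close> by blast
    ultimately have "x \<in> U z" "y \<in> U z" using V(4)[of x y z] xy by auto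
    then show "\<bar>f x - f y\<bar> \<le> e" unfolding U_def mem_Collect_eq by linarith
  qed
qed

lemma step_approximable_atMost: "step_approximable (indicat_real {..a::'a::linorder})"
  unfolding step_approximable_def
proof (intro allI impI)
  fix e :: real assume "e > 0"
  then show "\<exists>T. finite T \<and> (\<forall>x y. x \<le> y \<and> {x..<y} \<inter> T = {} \<longrightarrow> \<bar>indicat_real {..a} x - indicat_real {..a} y\<bar> \<le> e)"
    by (intro exI[of _ "{a}"]) (auto simp: indicator_def)
qed

lemma step_approximable_add:
  assumes "step_approximable f" "step_approximable g"
  shows "step_approximable (\<lambda>x. f x + g x)"
  unfolding step_approximable_def
proof (intro allI impI)
  fix e :: real assume "e > 0"
  then have "e / 2 > 0" by simp
  then obtain S T where S: "finite S" "\<And>x y. x \<le> y \<Longrightarrow> {x..<y} \<inter> S = {} \<Longrightarrow> \<bar>f x - f y\<bar> \<le> e / 2"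
    and T: "finite T" "\<And>x y. x \<le> y \<Longrightarrow> {x..<y} \<inter> T = {} \<Longrightarrow> \<bar>g x - g y\<bar> \<le> e / 2"
    using assms unfolding step_approximable_def by meson
  have "\<bar>f x + g x - (f y + g y)\<bar> \<le> e" if "x \<le> y" "{x..<y} \<inter> (S \<union> T) = {}" for x y
    using S(2)[of x y] T(2)[of x y] that unfolding Int_Un_distrib by (smt (verit) Un_empty field_sum_of_halves)
  then show "\<exists>T. finite T \<and> (\<forall>x y. x \<le> y \<and> {x..<y} \<inter> T = {} \<longrightarrow> \<bar>f x + g x - (f y + g y)\<bar> \<le> e)"
    using S(1) T(1) by (intro exI[of _ "S \<union> T"]) auto
qed

lemma step_approximable_cmult:
  assumes "step_approximable f"
  shows "step_approximable (\<lambda>x. c * f x)"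
  unfolding step_approximable_def
proof (intro allI impI)
  fix e :: real assume "e > 0"
  then have "e / (\<bar>c\<bar> + 1) > 0" by (intro divide_pos_pos) (auto intro: add_nonneg_pos)
  then obtain S where S: "finite S" "\<And>x y. x \<le> y \<Longrightarrow> {x..<y} \<inter> S = {} \<Longrightarrow> \<bar>f x - f y\<bar> \<le> e / (\<bar>c\<bar> + 1)"
    using assms unfolding step_approximable_def by meson
  have "\<bar>c * f x - c * f y\<bar> \<le> e" if "x \<le> y" "{x..<y} \<inter> S = {}" for x y
  proof -
    have "\<bar>c * f x - c * f y\<bar> = \<bar>c\<bar> * \<bar>f x - f y\<bar>" by (simp add: abs_mult flip: right_diff_distrib)
    also have "\<dots> \<le> (\<bar>c\<bar> + 1) * (e / (\<bar>c\<bar> + 1))" using S(2)[OF that] by (intro mult_mono) auto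
    finally show ?thesis by (simp add: add_nonneg_eq_0_iff) 
  qed
  then show "\<exists>T. finite T \<and> (\<forall>x y. x \<le> y \<and> {x..<y} \<inter> T = {} \<longrightarrow> \<bar>c * f x - c * f y\<bar> \<le> e)"
    using S(1) by auto
qed

lemma step_approximable_sum:
  fixes f :: "'b \<Rightarrow> 'a::linorder \<Rightarrow> real"
  assumes "\<And>t. t \<in> A \<Longrightarrow> step_approximable (f t)"
  shows "step_approximable (\<lambda>x. \<Sum>t\<in>A. f t x)"
proof -
  have "step_approximable (\<lambda>x::'a. 0::real)" by (force simp: step_approximable_def)
  then show ?thesis using assms by (induction A rule: infinite_finite_induct) (auto intro: step_approximable_add)
qed

section \<open>Riemann sums\<close>

text \<open>A partition sum for the integral against the measure with distribution function
  \<open>H\<close>. The leading term carries the mass of the ray up to the first node; on a later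
  block (s, t] the integrand is sampled at t, the end that belongs to the block.\<close>

definition riemann_sum :: "('a \<Rightarrow> real) \<Rightarrow> ('a \<Rightarrow> real) \<Rightarrow> 'a list \<Rightarrow> real" where
  "riemann_sum h H xs = h (hd xs) * H (hd xs) +
     (\<Sum>j < length xs - 1. h (xs ! Suc j) * (H (xs ! Suc j) - H (xs ! j)))"

lemma riemann_sum_single: "riemann_sum h H [x] = h x * H x"
  by (simp add: riemann_sum_def)

lemma riemann_sum_snoc:
  assumes "xs \<noteq> []"
  shows "riemann_sum h H (xs @ [x]) = riemann_sum h H xs + h x * (H x - H (last xs))"
proof -
  obtain n where n: "length xs = Suc n" using assms by (cases xs) auto
  have "(\<Sum>j < n. h ((xs @ [x]) ! Suc j) * (H ((xs @ [x]) ! Suc j) - H ((xs @ [x]) ! j)))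
      = (\<Sum>j < n. h (xs ! Suc j) * (H (xs ! Suc j) - H (xs ! j)))"
    by (intro sum.cong) (auto simp: nth_append n)
  then show ?thesis using assms n
    by (simp add: riemann_sum_def nth_append last_conv_nth)
qed

lemma riemann_sum_diff:
  "riemann_sum h (\<lambda>t. A t - B t) xs = riemann_sum h A xs - riemann_sum h B xs"
  by (simp add: riemann_sum_def algebra_simps sum.distrib sum_subtractf)

lemma abs_riemann_sum_le:
  assumes "\<And>x. \<bar>h x\<bar> \<le> C"
  shows "\<bar>riemann_sum h H xs\<bar> \<le> C * (\<bar>H (hd xs)\<bar> + (\<Sum>j < length xs - 1. \<bar>H (xs ! Suc j) - H (xs ! j)\<bar>))"
proof -
  have "\<bar>h x * y\<bar> \<le> C * \<bar>y\<bar>" for x y using assms by (simp add: abs_mult mult_right_mono)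
  then have "\<bar>h (hd xs) * H (hd xs)\<bar> + (\<Sum>j < length xs - 1. \<bar>h (xs ! Suc j) * (H (xs ! Suc j) - H (xs ! j))\<bar>)
     \<le> C * \<bar>H (hd xs)\<bar> + (\<Sum>j < length xs - 1. C * \<bar>H (xs ! Suc j) - H (xs ! j)\<bar>)"
    by (intro add_mono sum_mono) auto
  moreover have "\<bar>\<Sum>j < length xs - 1. h (xs ! Suc j) * (H (xs ! Suc j) - H (xs ! j))\<bar>
     \<le> (\<Sum>j < length xs - 1. \<bar>h (xs ! Suc j) * (H (xs ! Suc j) - H (xs ! j))\<bar>)" by (rule sum_abs)
  ultimately show ?thesis unfolding riemann_sum_def
    unfolding distrib_left sum_distrib_left by (rule order_trans[OF abs_triangle_ineq order_trans[rotated], OF _ add_left_mono])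
qed

lemma borel_sets_ray [measurable, simp]: "{..t::'a::linorder_topology} \<in> sets borel"
  by (intro borel_closed closed_atMost)

lemma borel_sets_Ioc [simp]: "{s<..t::'a::linorder_topology} \<in> sets borel"
  proof -
  have "{s<..t} = {..t} - {..s}" by auto
  then show ?thesis by (simp add: sets.Diff)
qed

lemma integrable_bounded_borel:
  fixes h :: "'a::topological_space \<Rightarrow> real"
  assumes "finite_measure M" "sets M = sets borel" "h \<in> borel_measurable borel" "\<And>x. \<bar>h x\<bar> \<le> C"
  shows "integrable M h"
proof -
  interpret finite_measure M by fact
  show ?thesis using assms(2-4) by (intro integrable_const_bound[where B=C]) (auto cong: measurable_cong_sets)
qed

lemma integral_close_to_const:
  fixes h :: "'a::topological_space \<Rightarrow> real"
  assumes "finite_measure M" "sets M = sets borel" "h \<in> borel_measurable borel" "\<And>x. \<bar>h x\<bar> \<le> C"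
    and A: "A \<in> sets borel" and close: "\<And>y. y \<in> A \<Longrightarrow> \<bar>h y - c\<bar> \<le> e"
  shows "\<bar>(\<integral>y. indicator A y * h y \<partial>M) - c * measure M A\<bar> \<le> e * measure M A"
proof -
  interpret finite_measure M by fact
  have [simp]: "A \<in> sets M" using A assms(2) by simp
  have i1: "integrable M (\<lambda>y. indicator A y * h y)"
    using integrable_mult_indicator[OF _ integrable_bounded_borel[OF assms(1-4)], of A] by simp
  have i2: "integrable M (indicator A :: 'a \<Rightarrow> real)" by (simp add: integrable_indicator_iff emeasure_finite flip: top.not_eq_extremum)
  have eq: "(\<integral>y. indicator A y * h y \<partial>M) - c * measure M A = (\<integral>y. indicator A y * h y - c * indicator A y \<partial>M)"
    using i1 i2 by simp
  have "\<bar>\<integral>y. indicator A y * h y - c * indicator A y \<partial>M\<bar> \<le> (\<integral>y. e * indicator A y \<partial>M)"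
  proof (rule order_trans[OF integral_abs_bound integral_mono])
    show "integrable M (\<lambda>y. \<bar>indicator A y * h y - c * indicator A y\<bar>)"
      using i1 i2 by (intro integrable_abs Bochner_Integration.integrable_diff integrable_mult_right)
    show "integrable M (\<lambda>y. e * indicator A y)" using i2 by (rule integrable_mult_right)
    show "\<bar>indicator A y * h y - c * indicator A y\<bar> \<le> e * indicator A y" for y
      using close[of y] by (simp add: indicator_def)
  qed
  also have "\<dots> = e * measure M A" using i2 by simp
  finally show ?thesis using eq by simp
qed

text \<open>Truncating the integral at \<open>last xs\<close> makes induction possible: a new last
  node \<open>x\<close> adds the block \<open>{l<..x}\<close>, on which \<open>h\<close> is within
  \<open>e\<close> of \<open>h x\<close>, and the errors add up like the measures of the
  blocks.\<close>

lemma integral_riemann_sum_aux: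
  fixes h :: "'a::linorder_topology \<Rightarrow> real"
  assumes M: "finite_measure M" "sets M = sets borel" and h: "h \<in> borel_measurable borel" "\<And>x. \<bar>h x\<bar> \<le> C"
    and "xs \<noteq> []" "sorted_wrt (<) xs"
    and "\<And>y z. z \<in> set xs \<Longrightarrow> y \<le> z \<Longrightarrow> {y..<z} \<inter> set xs = {} \<Longrightarrow> \<bar>h y - h z\<bar> \<le> e"
  shows "\<bar>(\<integral>y. indicator {..last xs} y * h y \<partial>M) - riemann_sum h (\<lambda>t. measure M {..t}) xs\<bar>
    \<le> e * measure M {..last xs}"
  using assms(5-)
proof (induction xs rule: rev_nonempty_induct)
  case (single x)
  then show ?case unfolding riemann_sum_single last.simps
    by (simp, intro integral_close_to_const[OF M h]) auto
next
  case (snoc x xs)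
  define l where "l = last xs"
  have l: "l \<in> set xs" using snoc.hyps by (simp add: l_def)
  have lx: "\<And>z. z \<in> set xs \<Longrightarrow> z < x" and s: "sorted_wrt (<) xs"
    using snoc.prems by (auto simp: sorted_wrt_append)
  have le_l: "z \<le> l" if "z \<in> set xs" for z
    using s snoc.hyps that unfolding l_def
    by (metis append_butlast_last_id in_set_conv_decomp_last less_imp_le order_refl rotate1.simps(2) set_ConsD set_rotate1 sorted_wrt_append list.set_intros(1))
  interpret finite_measure M by (rule M)
  have IH: "\<bar>(\<integral>y. indicator {..l} y * h y \<partial>M) - riemann_sum h (\<lambda>t. measure M {..t}) xs\<bar>
    \<le> e * measure M {..l}" unfolding l_def
  proof (rule snoc.IH[OF s])
    fix y z assume z: "z \<in> set xs" "y \<le> z" "{y..<z} \<inter> set xs = {}"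
    then show "\<bar>h y - h z\<bar> \<le> e" using lx[OF z(1)] by (intro snoc.prems(2)) auto
  qed
  have "\<bar>h y - h x\<bar> \<le> e" if "y \<in> {l<..x}" for y
    using that le_l by (intro snoc.prems(2)) force+
  then have A: "\<bar>(\<integral>y. indicator {l<..x} y * h y \<partial>M) - h x * measure M {l<..x}\<bar> \<le> e * measure M {l<..x}"
    by (intro integral_close_to_const[OF M h]) auto
  have un: "{..x} = {..l} \<union> {l<..x}" using lx[OF l] by auto
  have ms: "measure M {..x} = measure M {..l} + measure M {l<..x}"
    unfolding un by (intro finite_measure_Union) (auto simp: M)
  have int: "integrable M (\<lambda>y. indicator A y * h y)" if "A \<in> sets borel" for A
    using integrable_mult_indicator[OF _ integrable_bounded_borel[OF M h], of A] that M by simp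
  have "(\<integral>y. indicator {..x} y * h y \<partial>M) = (\<integral>y. indicator {..l} y * h y + indicator {l<..x} y * h y \<partial>M)"
    by (intro Bochner_Integration.integral_cong) (use lx[OF l] in \<open>auto simp: indicator_def\<close>)
  also have "\<dots> = (\<integral>y. indicator {..l} y * h y \<partial>M) + (\<integral>y. indicator {l<..x} y * h y \<partial>M)"
    by (intro Bochner_Integration.integral_add int) auto
  finally have int_split: "(\<integral>y. indicator {..x} y * h y \<partial>M) = (\<integral>y. indicator {..l} y * h y \<partial>M) + (\<integral>y. indicator {l<..x} y * h y \<partial>M)" .
  have rs: "riemann_sum h (\<lambda>t. measure M {..t}) (xs @ [x]) =
     riemann_sum h (\<lambda>t. measure M {..t}) xs + h x * measure M {l<..x}"
    using riemann_sum_snoc[OF snoc.hyps(1)] ms l_def by simp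
  show ?case using IH A unfolding rs by (simp add: int_split ms distrib_left)
qed

text \<open>The nodes \<open>T\<close> depend on \<open>h\<close> and \<open>e\<close> only. One
  partition can thus serve several measures at once, which the comparison of signed integrals
  requires.\<close>

lemma integral_riemann_sum:
  fixes h :: "'a::linorder_topology \<Rightarrow> real"
  assumes K: "compact (UNIV :: 'a set)"
    and h: "h \<in> borel_measurable borel" "\<And>x. \<bar>h x\<bar> \<le> C" "step_approximable h" and e: "e > 0"
  shows "\<exists>T. finite T \<and> (\<forall>xs M. sorted_wrt (<) xs \<and> T \<subseteq> set xs \<and> finite_measure M \<and> sets M = sets borel \<longrightarrow>
     hd xs = line_min \<and>
     \<bar>integral\<^sup>L M h - riemann_sum h (\<lambda>t. measure M {..t}) xs\<bar> \<le> e * measure M UNIV)"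
proof -
  obtain T where T: "finite T" "\<And>x y. x \<le> y \<Longrightarrow> {x..<y} \<inter> T = {} \<Longrightarrow> \<bar>h x - h y\<bar> \<le> e"
    using h(3) e unfolding step_approximable_def by meson
  obtain m where m: "\<And>y::'a. y \<le> m" using ex_line_max[OF K] by auto
  show ?thesis
  \<comment> \<open>\<open>line_min\<close> makes the first block a single point, and
    \<open>m\<close> makes the blocks exhaust the line.\<close>
  proof (intro exI[of _ "T \<union> {line_min, m}"] conjI allI impI)
    show "finite (T \<union> {line_min, m})" using T by simp
    fix xs and M :: "'a measure" assume *: "sorted_wrt (<) xs \<and> T \<union> {line_min, m} \<subseteq> set xs \<and> finite_measure M \<and> sets M = sets borel"
    then have ne: "xs \<noteq> []" by auto
    obtain x ys where x: "xs = x # ys" using ne by (cases xs) auto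
    show "hd xs = line_min"
      using * line_min_le[OF K, of x] unfolding x by (auto intro: antisym)
    have "last xs = m"
    proof -
      obtain ys y where y: "xs = ys @ [y]" using ne by (metis append_butlast_last_id)
      then show ?thesis using * m[of y] by (auto simp: sorted_wrt_append intro: antisym)
    qed
    then have "{..last xs} = UNIV" using m by auto
    moreover have "\<bar>(\<integral>y. indicator {..last xs} y * h y \<partial>M) - riemann_sum h (\<lambda>t. measure M {..t}) xs\<bar>
      \<le> e * measure M {..last xs}"
    proof (rule integral_riemann_sum_aux[OF _ _ h(1,2) ne])
      fix y z assume "z \<in> set xs" "y \<le> z" "{y..<z} \<inter> set xs = {}"
      then show "\<bar>h y - h z\<bar> \<le> e" using * by (intro T(2)) auto
    qed (use * in auto)
    ultimately show "\<bar>integral\<^sup>L M h - riemann_sum h (\<lambda>t. measure M {..t}) xs\<bar> \<le> e * measure M UNIV"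
      by simp
  qed
qed

section \<open>Signed integrals controlled by the distribution function\<close>

lemma bv_norm_upper:
  assumes "bounded_variation G" "sorted_wrt (<) xs"
  shows "\<bar>G line_min\<bar> + (\<Sum>j < length xs - 1. \<bar>G (xs ! Suc j) - G (xs ! j)\<bar>) \<le> bv_norm G"
  unfolding bv_norm_def total_variation_def
  by (intro add_left_mono cSup_upper) (use assms in \<open>auto simp: var_sums_def bounded_variation_def\<close>)

lemma bounded_variationI:
  assumes "\<And>xs. sorted_wrt (<) xs \<Longrightarrow>
    \<bar>G line_min\<bar> + (\<Sum>j < length xs - 1. \<bar>G (xs ! Suc j) - G (xs ! j)\<bar>) \<le> C"
  shows "bounded_variation G" "bv_norm G \<le> C"
proof -
  have le: "y \<le> C - \<bar>G line_min\<bar>" if "y \<in> var_sums G" for y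
    using that assms by (force simp: var_sums_def)
  show "bounded_variation G" unfolding bounded_variation_def using le by (intro bdd_aboveI)
  have "total_variation G \<le> C - \<bar>G line_min\<bar>" unfolding total_variation_def
  proof (rule cSup_least)
    have "(\<Sum>j < length ([]::'a list) - 1. \<bar>G (([]::'a list) ! Suc j) - G ([] ! j)\<bar>) \<in> var_sums G"
      unfolding var_sums_def by (rule imageI) simp
    then show "var_sums G \<noteq> {}" by blast
  qed (rule le)
  then show "bv_norm G \<le> C" unfolding bv_norm_def by simp
qed

lemma associated_measureD:
  fixes G :: "'a::linorder_topology \<Rightarrow> real"
  assumes K: "compact (UNIV :: 'a set)" and "associated_measure G M1 M2"
  shows "finite_measure M1" "finite_measure M2" "sets M1 = sets borel" "sets M2 = sets borel"
    "G = (\<lambda>t. measure M1 {..t} - measure M2 {..t})"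
proof -
  have "{line_min..t} = {..t}" for t :: 'a using line_min_le[OF K] by auto
  then show "finite_measure M1" "finite_measure M2" "sets M1 = sets borel" "sets M2 = sets borel"
    "G = (\<lambda>t. measure M1 {..t} - measure M2 {..t})"
    using assms(2) by (auto simp: associated_measure_def regular_finite_borel_def)
qed

lemma abs_integral_le_bv_norm:
  fixes h :: "'a::linorder_topology \<Rightarrow> real"
  assumes K: "compact (UNIV :: 'a set)"
    and h: "h \<in> borel_measurable borel" "\<And>x. \<bar>h x\<bar> \<le> C" "step_approximable h"
    and G: "associated_measure G M1 M2" "bounded_variation G"
  shows "\<bar>integral\<^sup>L M1 h - integral\<^sup>L M2 h\<bar> \<le> C * bv_norm G"
proof (rule field_le_epsilon)
  fix e :: real assume e: "e > 0"
  note D = associated_measureD[OF K G(1)]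
  define m where "m = measure M1 UNIV + measure M2 UNIV + 1"
  have m: "m > 0" by (simp add: m_def add_nonneg_pos)
  then have "e / m > 0" using e by simp
  then obtain T where T: "finite T"
    "\<And>xs M. sorted_wrt (<) xs \<Longrightarrow> T \<subseteq> set xs \<Longrightarrow> finite_measure M \<Longrightarrow> sets M = sets borel \<Longrightarrow>
     hd xs = line_min \<and>
     \<bar>integral\<^sup>L M h - riemann_sum h (\<lambda>t. measure M {..t}) xs\<bar> \<le> e / m * measure M UNIV"
    using integral_riemann_sum[OF K h] by meson
  define xs where "xs = sorted_list_of_set T"
  have xs: "sorted_wrt (<) xs" "T \<subseteq> set xs" using T(1) by (auto simp: xs_def)
  note R = T(2)[OF xs D(1,3)] T(2)[OF xs D(2,4)]
  have "\<bar>riemann_sum h G xs\<bar> \<le> C * (\<bar>G (hd xs)\<bar> + (\<Sum>j < length xs - 1. \<bar>G (xs ! Suc j) - G (xs ! j)\<bar>))"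
    by (rule abs_riemann_sum_le[OF h(2)])
  \<comment> \<open>The bound on \<open>h\<close> at a single point gives
    \<open>0 \<le> C\<close>.\<close>
  also have "\<dots> \<le> C * bv_norm G"
    using bv_norm_upper[OF G(2) xs(1)] R h(2)[of undefined] by (intro mult_left_mono) auto
  finally have 1: "\<bar>riemann_sum h G xs\<bar> \<le> C * bv_norm G" .
  have "riemann_sum h G xs = riemann_sum h (\<lambda>t. measure M1 {..t}) xs - riemann_sum h (\<lambda>t. measure M2 {..t}) xs"
    unfolding D(5) by (rule riemann_sum_diff)
  then have "\<bar>integral\<^sup>L M1 h - integral\<^sup>L M2 h\<bar> \<le> C * bv_norm G + e / m * (measure M1 UNIV + measure M2 UNIV)"
    using 1 R unfolding distrib_left by linarith
  also have "e / m * (measure M1 UNIV + measure M2 UNIV) \<le> e / m * m"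
    using e m by (intro mult_left_mono) (auto simp: m_def)
  finally show "\<bar>integral\<^sup>L M1 h - integral\<^sup>L M2 h\<bar> \<le> C * bv_norm G + e" using m by simp
qed

text \<open>The Riemann sums of both sides agree term by term once the partition contains T0.\<close>
lemma signed_integral_eqI:
  fixes h h' :: "'a::linorder_topology \<Rightarrow> real"
  assumes K: "compact (UNIV :: 'a set)"
    and h: "h \<in> borel_measurable borel" "\<And>x. \<bar>h x\<bar> \<le> C" "step_approximable h"
    and h': "h' \<in> borel_measurable borel" "\<And>x. \<bar>h' x\<bar> \<le> C'" "step_approximable h'"
    and M: "finite_measure M1" "finite_measure M2" "sets M1 = sets borel" "sets M2 = sets borel"
    and M': "finite_measure N1" "finite_measure N2" "sets N1 = sets borel" "sets N2 = sets borel"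
    and G: "\<And>t. measure M1 {..t} - measure M2 {..t} = G t" 
      "\<And>t. measure N1 {..t} - measure N2 {..t} = G t" 
    and T0: "finite T0" "\<And>x y. x < y \<Longrightarrow> {x<..<y} \<inter> T0 = {} \<Longrightarrow> h y * (G y - G x) = h' y * (G y - G x)"
    and min: "h line_min * G line_min = h' line_min * G line_min"
  shows "integral\<^sup>L M1 h - integral\<^sup>L M2 h = integral\<^sup>L N1 h' - integral\<^sup>L N2 h'"
proof -
  define m where "m = measure M1 UNIV + measure M2 UNIV + measure N1 UNIV + measure N2 UNIV + 1"
  have m: "m > 0" by (simp add: m_def add_nonneg_pos)
  have "\<bar>(integral\<^sup>L M1 h - integral\<^sup>L M2 h) - (integral\<^sup>L N1 h' - integral\<^sup>L N2 h')\<bar> \<le> e" if e: "e > 0" for e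
  proof -
    have "e / m > 0" using e m by simp
    then obtain T where T: "finite T"
      "\<And>xs M. sorted_wrt (<) xs \<Longrightarrow> T \<subseteq> set xs \<Longrightarrow> finite_measure M \<Longrightarrow> sets M = sets borel \<Longrightarrow>
       hd xs = line_min \<and>
       \<bar>integral\<^sup>L M h - riemann_sum h (\<lambda>t. measure M {..t}) xs\<bar> \<le> e / m * measure M UNIV"
      using integral_riemann_sum[OF K h] by meson
    obtain T' where T': "finite T'"
      "\<And>xs M. sorted_wrt (<) xs \<Longrightarrow> T' \<subseteq> set xs \<Longrightarrow> finite_measure M \<Longrightarrow> sets M = sets borel \<Longrightarrow>
       hd xs = line_min \<and>
       \<bar>integral\<^sup>L M h' - riemann_sum h' (\<lambda>t. measure M {..t}) xs\<bar> \<le> e / m * measure M UNIV"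
      using integral_riemann_sum[OF K h'] \<open>e / m > 0\<close> by meson
    define xs where "xs = sorted_list_of_set (T \<union> T' \<union> T0)"
    have xs: "sorted_wrt (<) xs" "T \<subseteq> set xs" "T' \<subseteq> set xs" "T0 \<subseteq> set xs"
      using T(1) T'(1) T0(1) by (auto simp: xs_def)
    have "riemann_sum h G xs = riemann_sum h' G xs"
      unfolding riemann_sum_def
    proof (intro arg_cong2[where f="(+)"] sum.cong refl)
      show "h (hd xs) * G (hd xs) = h' (hd xs) * G (hd xs)" using T(2)[OF xs(1,2) M(1,3)] min by simp
      fix j assume "j \<in> {..<length xs - 1}"
      then have j: "Suc j < length xs" by auto
      \<comment> \<open>Consecutive nodes have no node strictly between them, in particular none of
        \<open>T0\<close>; this is the premise of \<open>T0(2)\<close>.\<close>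
      have "{xs ! j<..<xs ! Suc j} \<inter> set xs = {}"
      proof (rule equals0I)
        fix z assume "z \<in> {xs ! j<..<xs ! Suc j} \<inter> set xs"
        then obtain k where k: "k < length xs" "xs ! j < xs ! k" "xs ! k < xs ! Suc j"
          by (auto simp: in_set_conv_nth)
        consider "k < j" | "k = j" | "k = Suc j" | "Suc j < k" by linarith
        then show False
          using k j sorted_wrt_nth_less[OF xs(1), of k j] sorted_wrt_nth_less[OF xs(1), of "Suc j" k]
          by cases auto
      qed
      then show "h (xs ! Suc j) * (G (xs ! Suc j) - G (xs ! j)) = h' (xs ! Suc j) * (G (xs ! Suc j) - G (xs ! j))"
        by (intro T0(2) sorted_wrt_nth_less[OF xs(1)]) (use j xs(4) in auto)
    qed
    then have "riemann_sum h (\<lambda>t. measure M1 {..t} - measure M2 {..t}) xs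
       = riemann_sum h' (\<lambda>t. measure N1 {..t} - measure N2 {..t}) xs" by (simp add: G)
    then have "\<bar>(integral\<^sup>L M1 h - integral\<^sup>L M2 h) - (integral\<^sup>L N1 h' - integral\<^sup>L N2 h')\<bar>
      \<le> e / m * (measure M1 UNIV + measure M2 UNIV + measure N1 UNIV + measure N2 UNIV)"
      using T(2)[OF xs(1,2) M(1,3)] T(2)[OF xs(1,2) M(2,4)] T'(2)[OF xs(1,3) M'(1,3)] T'(2)[OF xs(1,3) M'(2,4)]
      unfolding riemann_sum_diff distrib_left by linarith
    also have "\<dots> \<le> e / m * m"
      using e m by (intro mult_left_mono) (auto simp: m_def)
    finally show ?thesis using m by simp
  qed
  from field_le_epsilon[of "\<bar>(integral\<^sup>L M1 h - integral\<^sup>L M2 h) - (integral\<^sup>L N1 h' - integral\<^sup>L N2 h')\<bar>" 0, unfolded add_0, OF this]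
  have "\<bar>(integral\<^sup>L M1 h - integral\<^sup>L M2 h) - (integral\<^sup>L N1 h' - integral\<^sup>L N2 h')\<bar> \<le> 0" .
  then show ?thesis by simp
qed

section \<open>The norm by duality\<close>

lemma regular_finite_borelD:
  assumes "regular_finite_borel M"
  shows "finite_measure M" "sets M = sets borel" "space M = UNIV"
  using assms sets_eq_imp_space_eq[of M borel] by (auto simp: regular_finite_borel_def)

lemma regular_outer_approx:
  assumes "regular_finite_borel M" "A \<in> sets borel" "e > 0"
  shows "\<exists>U. open U \<and> A \<subseteq> U \<and> measure M U < measure M A + e"
proof -
  have "measure M A = Inf (measure M ` {U. open U \<and> A \<subseteq> U})"
    using assms by (simp add: regular_finite_borel_def)
  then have "Inf (measure M ` {U. open U \<and> A \<subseteq> U}) < measure M A + e" using assms(3) by simp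
  then obtain y where "y \<in> measure M ` {U. open U \<and> A \<subseteq> U}" "y < measure M A + e"
    using cInf_lessD[of "measure M ` {U. open U \<and> A \<subseteq> U}"] by blast
  then show ?thesis by auto
qed

text \<open>Outer regularity yields open sets around the ray whose measure exceeds that of the ray
  by less than \<open>d\<close>; the integral of a cutoff that vanishes outside their intersection
  is squeezed in between. The premise \<open>x < z\<close> sits inside the conclusion because the
  lemma is applied to \<open>ys ! j\<close> and \<open>ys ! Suc j\<close> for all \<open>j\<close>,
  including indices out of range.\<close>

lemma cutoff_approx:
  fixes x z :: "'a::linorder_topology"
  assumes K: "compact (UNIV :: 'a set)" and M: "regular_finite_borel M1" "regular_finite_borel M2" and d: "d > 0"
  shows "\<exists>q. continuous_on UNIV q \<and> (\<forall>y. 0 \<le> q y \<and> q y \<le> 1) \<and> (\<forall>y\<le>x. q y = 1) \<and> (\<forall>y\<ge>z. x < z \<longrightarrow> q y = 0) \<and>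
    \<bar>integral\<^sup>L M1 q - measure M1 {..x}\<bar> \<le> d \<and> \<bar>integral\<^sup>L M2 q - measure M2 {..x}\<bar> \<le> (d::real)"
proof (cases "\<exists>w. x < w")
  case False
  then have "{..x} = UNIV" by (auto simp: not_less)
  then show ?thesis using False d regular_finite_borelD[OF M(1)] regular_finite_borelD[OF M(2)]
    by (intro exI[of _ "\<lambda>_. 1"]) auto
next
  case True
  then obtain w where w: "x < w" "x < z \<longrightarrow> w \<le> z" by (metis order_refl)
  obtain U1 where U1: "open U1" "{..x} \<subseteq> U1" "measure M1 U1 < measure M1 {..x} + d"
    using regular_outer_approx[OF M(1) borel_sets_ray d] by blast
  obtain U2 where U2: "open U2" "{..x} \<subseteq> U2" "measure M2 U2 < measure M2 {..x} + d"
    using regular_outer_approx[OF M(2) borel_sets_ray d] by blast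
  have "open (U1 \<inter> U2)" "x \<in> U1 \<inter> U2" using U1 U2 by auto
  from open_right[OF this w(1)] obtain b where b: "x < b" "{x..<b} \<subseteq> U1 \<inter> U2" by auto
  \<comment> \<open>\<open>b\<close> keeps the points where the cutoff is nonzero inside both open
    sets, and \<open>w\<close> makes it vanish from \<open>z\<close> on.\<close>
  define y where "y = min b w"
  have "s \<in> U1 \<inter> U2" if "s < y" for s
    using that b U1(2) U2(2) unfolding y_def by (cases "s \<le> x") (auto simp: subset_eq)
  then have y: "x < y" "y \<le> w" "{..<y} \<subseteq> U1" "{..<y} \<subseteq> U2"
    using b w by (auto simp: y_def)
  obtain q where q0: "continuous_on UNIV q \<and> (\<forall>s. 0 \<le> q s \<and> q s \<le> (1::real)) \<and> (\<forall>s\<le>x. q s = 1) \<and> (\<forall>s\<ge>y. q s = 0)"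
    using continuous_cutoff_between[OF K y(1)] ..
  then have q: "continuous_on UNIV q" "\<And>s. 0 \<le> q s" "\<And>s. q s \<le> 1"
    "\<And>s. s \<le> x \<Longrightarrow> q s = 1" "\<And>s. y \<le> s \<Longrightarrow> q s = 0"
    by simp_all
  have est: "\<bar>integral\<^sup>L M q - measure M {..x}\<bar> \<le> d"
    if M: "regular_finite_borel M" and U: "open U" "{..<y} \<subseteq> U" "measure M U < measure M {..x} + d" for M U
  proof -
    note R = regular_finite_borelD[OF M]
    interpret finite_measure M by (rule R)
    have iq: "integrable M q"
      by (rule integrable_bounded_borel[OF R(1,2), of _ 1])
        (use q in \<open>auto intro: borel_measurable_continuous_onI\<close>)
    have ii: "integrable M (indicat_real A)" if "A \<in> sets borel" for A
      using that by (simp add: R integrable_indicator_iff emeasure_finite flip: top.not_eq_extremum)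
    have "measure M {..x} = (\<integral>s. indicator {..x} s \<partial>M)" using R by simp
    also have "\<dots> \<le> integral\<^sup>L M q"
      by (rule integral_mono[OF ii iq]) (use q in \<open>auto simp: indicator_def\<close>)
    finally have 1: "measure M {..x} \<le> integral\<^sup>L M q" .
    have "integral\<^sup>L M q \<le> (\<integral>s. indicator U s \<partial>M)"
    proof (rule integral_mono[OF iq ii])
      show "q s \<le> indicator U s" for s
        using q(3,5)[of s] U(2) by (cases "y \<le> s") (auto simp: indicator_def subset_eq not_le)
    qed (use U in simp)
    also have "\<dots> = measure M U" using R by simp
    finally show ?thesis using 1 U by linarith
  qed
  show ?thesis
  proof (intro exI[of _ q] conjI allI impI)
    fix s assume "z \<le> s" "x < z"
    then show "q s = 0" using w y by (intro q) auto
  qed (use q est[OF M(1) U1(1) y(3) U1(3)] est[OF M(2) U2(1) y(4) U2(3)] in auto)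
qed

text \<open>The test function is a signed sum of differences of cutoffs at neighbouring nodes. The
  differences are nonnegative and telescope to the last cutoff, so the sum is bounded by 1, while
  its integral is close to the variation along \<open>ys\<close>.\<close>

lemma bv_norm_le_functional_aux:
  fixes G :: "'a::linorder_topology \<Rightarrow> real"
  assumes K: "compact (UNIV :: 'a set)" and G: "associated_measure G M1 M2"
    and C: "\<And>f. continuous_on UNIV f \<Longrightarrow> (\<And>x. \<bar>f x\<bar> \<le> 1) \<Longrightarrow> \<bar>integral\<^sup>L M1 f - integral\<^sup>L M2 f\<bar> \<le> C"
    and ys: "sorted_wrt (<) ys" "ys \<noteq> []"
  shows "\<bar>G (hd ys)\<bar> + (\<Sum>j < length ys - 1. \<bar>G (ys ! Suc j) - G (ys ! j)\<bar>) \<le> C"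
proof -
  note D = associated_measureD[OF K G]
  have M: "regular_finite_borel M1" "regular_finite_borel M2"
    using G by (auto simp: associated_measure_def)
  define n where "n = length ys - 1"
  define I where "I f = integral\<^sup>L M1 f - integral\<^sup>L M2 f" for f :: "'a \<Rightarrow> real"
  \<comment> \<open>The value at the first node counts as an increment from 0, in step with the zero
    function \<open>p 0\<close> below.\<close>
  define \<Delta> where "\<Delta> j = (if j = 0 then G (ys ! 0) else G (ys ! j) - G (ys ! (j - 1)))" for j
  have S: "\<bar>G (hd ys)\<bar> + (\<Sum>j < length ys - 1. \<bar>G (ys ! Suc j) - G (ys ! j)\<bar>) = (\<Sum>j\<le>n. \<bar>\<Delta> j\<bar>)"
    using ys(2) unfolding n_def[symmetric] by (simp add: \<Delta>_def sum.atMost_shift hd_conv_nth)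
  have "(\<Sum>j\<le>n. \<bar>\<Delta> j\<bar>) \<le> C + e" if e: "e > 0" for e
  proof -
    \<comment> \<open>Each cutoff integral is within \<open>2 * d\<close> of the value of
      \<open>G\<close>, an error of \<open>d\<close> for each measure; an increment uses two
      cutoffs, and there are \<open>n + 1\<close> increments.\<close>
    define d where "d = e / (4 * (real n + 1))"
    have d: "d > 0" using e by (simp add: d_def)
    have "\<exists>q. \<forall>j. continuous_on UNIV (q j) \<and> (\<forall>y. 0 \<le> q j y \<and> q j y \<le> 1) \<and> (\<forall>y\<le>ys ! j. q j y = 1) \<and>
        (\<forall>y\<ge>ys ! Suc j. ys ! j < ys ! Suc j \<longrightarrow> q j y = 0) \<and>
        \<bar>integral\<^sup>L M1 (q j) - measure M1 {..ys ! j}\<bar> \<le> d \<and> \<bar>integral\<^sup>L M2 (q j) - measure M2 {..ys ! j}\<bar> \<le> d"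
      by (rule choice, rule allI, rule cutoff_approx[OF K M d])
    then obtain q where q: "\<And>j. continuous_on UNIV (q j)" "\<And>j y. 0 \<le> q j y" "\<And>j y. q j y \<le> 1"
      "\<And>j y. y \<le> ys ! j \<Longrightarrow> q j y = 1" "\<And>j y. ys ! j < ys ! Suc j \<Longrightarrow> ys ! Suc j \<le> y \<Longrightarrow> q j y = 0"
      "\<And>j. \<bar>integral\<^sup>L M1 (q j) - measure M1 {..ys ! j}\<bar> \<le> d" "\<And>j. \<bar>integral\<^sup>L M2 (q j) - measure M2 {..ys ! j}\<bar> \<le> d"
      by blast
    have Iq: "\<bar>I (q j) - G (ys ! j)\<bar> \<le> 2 * d" for j
      using q(6,7)[of j] unfolding I_def D(5) by linarith
    define p where "p j = (if j = 0 then (\<lambda>_. 0) else q (j - 1))" for j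
    define s where "s j = (if 0 \<le> \<Delta> j then 1 else - 1 :: real)" for j
    define f where "f x = (\<Sum>j\<le>n. s j * (q j x - p j x))" for x
    \<comment> \<open>Up to node \<open>j\<close> the later cutoff is 1; beyond it the earlier one
      is already 0.\<close>
    have nonneg: "0 \<le> q j x - p j x" if "j \<le> n" for j x
    proof (cases j)
      case 0
      then show ?thesis using q(2) by (simp add: p_def)
    next
      case (Suc k)
      have "ys ! k < ys ! Suc k"
        using sorted_wrt_nth_less[OF ys(1), of k "Suc k"] that Suc ys(2) by (cases ys) (auto simp: n_def)
      then show ?thesis using q(4)[of x j] q(5)[of k x] q(2)[of j x] q(3)[of k x] Suc
        by (cases "x \<le> ys ! j") (auto simp: p_def)
    qed
    have tel: "(\<Sum>j\<le>m. q j x - p j x) = q m x" for m x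
      by (induction m) (auto simp: p_def)
    have f1: "\<bar>f x\<bar> \<le> 1" for x
    proof -
      have "\<bar>f x\<bar> \<le> (\<Sum>j\<le>n. \<bar>s j * (q j x - p j x)\<bar>)" unfolding f_def by (rule sum_abs)
      also have "\<dots> = (\<Sum>j\<le>n. q j x - p j x)"
        by (rule sum.cong) (use nonneg in \<open>auto simp: s_def abs_mult\<close>)
      also have "\<dots> \<le> 1" unfolding tel by (rule q)
      finally show ?thesis .
    qed
    have cp: "continuous_on UNIV (p j)" "\<bar>p j x\<bar> \<le> 1" for j x
      using q(1)[of "j - 1"] q(2,3)[of "j - 1" x] by (auto simp: p_def)
    have cf: "continuous_on UNIV f"
      unfolding f_def by (intro continuous_intros q cp)
    have int: "integrable M1 g" "integrable M2 g" if "continuous_on UNIV g" "\<And>x. \<bar>g x\<bar> \<le> 1" for g :: "'a \<Rightarrow> real"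
      using that by (auto intro!: integrable_bounded_borel[of _ _ 1] D borel_measurable_continuous_onI)
    have intq: "integrable M1 (q j)" "integrable M2 (q j)" for j
      using q(2,3)[of j] by (auto intro!: int q(1))
    have intp: "integrable M1 (p j)" "integrable M2 (p j)" for j
      by (intro int cp)+
    have "I f = (\<Sum>j\<le>n. s j * (I (q j) - I (p j)))"
      unfolding I_def f_def using intq intp
      by (simp add: Bochner_Integration.integral_sum sum_subtractf[symmetric] algebra_simps)
    moreover have "s j * (I (q j) - I (p j)) \<ge> \<bar>\<Delta> j\<bar> - 4 * d" for j
    proof -
      have "\<bar>I (p j) - (if j = 0 then 0 else G (ys ! (j - 1)))\<bar> \<le> 2 * d"
        using Iq[of "j - 1"] d by (auto simp: p_def I_def)
      then have "\<bar>(I (q j) - I (p j)) - \<Delta> j\<bar> \<le> 4 * d"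
        using Iq[of j] unfolding \<Delta>_def by (auto split: if_splits)
      then show ?thesis unfolding s_def by (auto simp: abs_le_iff)
    qed
    ultimately have "I f \<ge> (\<Sum>j\<le>n. \<bar>\<Delta> j\<bar> - 4 * d)" by (simp only: sum_mono)
    moreover have "(\<Sum>j\<le>n. \<bar>\<Delta> j\<bar> - 4 * d) = (\<Sum>j\<le>n. \<bar>\<Delta> j\<bar>) - (real n + 1) * (4 * d)"
      by (simp add: sum_subtractf algebra_simps)
    moreover have "(real n + 1) * (4 * d) = e" by (simp add: d_def field_simps)
    ultimately show ?thesis using C[OF cf f1] unfolding I_def by linarith
  qed
  then have "(\<Sum>j\<le>n. \<bar>\<Delta> j\<bar>) \<le> C" by (rule field_le_epsilon)
  then show ?thesis using S by simp
qed

text \<open>The norm starts at \<open>line_min\<close>, the test-function bound at the first node;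
  prepending \<open>line_min\<close> to the list can only enlarge the sum.\<close>

lemma bv_norm_le_functional:
  fixes G :: "'a::linorder_topology \<Rightarrow> real"
  assumes K: "compact (UNIV :: 'a set)" and G: "associated_measure G M1 M2"
    and C: "\<And>f. continuous_on UNIV f \<Longrightarrow> (\<And>x. \<bar>f x\<bar> \<le> 1) \<Longrightarrow> \<bar>integral\<^sup>L M1 f - integral\<^sup>L M2 f\<bar> \<le> C"
  shows "bv_norm G \<le> C"
proof (rule bounded_variationI(2))
  note aux = bv_norm_le_functional_aux[OF K G C]
  fix xs :: "'a list" assume xs: "sorted_wrt (<) xs"
  show "\<bar>G line_min\<bar> + (\<Sum>j < length xs - 1. \<bar>G (xs ! Suc j) - G (xs ! j)\<bar>) \<le> C"
  proof (cases "xs \<noteq> [] \<and> hd xs = line_min")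
    case True
    then show ?thesis using aux[OF _ _ xs] by auto
  next
    case False
    have "line_min < x" if "x \<in> set xs" for x
      using False that line_min_le[OF K] xs 
      by (cases xs) (auto simp: order.strict_iff_order intro: order_trans dest: antisym)
    then have "sorted_wrt (<) (line_min # xs)" using xs by simp
    from aux[OF _ _ this] show ?thesis by (cases xs) (simp_all add: sum.lessThan_Suc_shift del: sum.lessThan_Suc)
  qed
qed

text \<open>Convergence to 0 bounds the integrals of each single function, Banach-Steinhaus makes
  the bound uniform over the unit ball, and duality turns it back into a bound on the
  variations.\<close>

lemma weak_star_null_bounded:
  fixes G :: "'i \<Rightarrow> 'a::linorder_topology \<Rightarrow> real"
  assumes K: "compact (UNIV :: 'a set)" and G: "weak_star_null_NBV G"
  shows "\<exists>C. \<forall>i. bv_norm (G i) \<le> C"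
proof -
  obtain M1 M2 where M: "\<And>i. associated_measure (G i) (M1 i) (M2 i)"
    and null: "\<And>f :: 'a \<Rightarrow> real. continuous_on UNIV f \<Longrightarrow> fam_lim0 (\<lambda>i. integral\<^sup>L (M1 i) f - integral\<^sup>L (M2 i) f)"
    using G unfolding weak_star_null_NBV_def by blast
  have bv: "bounded_variation (G i)" for i
    using G by (auto simp: weak_star_null_NBV_def NBV_def)
  define T where "T i f = integral\<^sup>L (M1 i) (apply_bcontfun f) - integral\<^sup>L (M2 i) (apply_bcontfun f)"
    for i and f :: "'a \<Rightarrow>\<^sub>C real"
  note D = associated_measureD[OF K M]
  have meas: "apply_bcontfun f \<in> borel_measurable borel" for f :: "'a \<Rightarrow>\<^sub>C real"
    by (intro borel_measurable_continuous_onI) simp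
  have nb: "\<bar>apply_bcontfun f x\<bar> \<le> norm f" for f :: "'a \<Rightarrow>\<^sub>C real" and x
    using norm_bounded[of f x] by simp
  note int = integrable_bounded_borel[OF D(1,3) meas nb] integrable_bounded_borel[OF D(2,4) meas nb]
  have lin: "bounded_linear (T i)" for i
  proof (rule bounded_linear_intro)
    show "T i (f + g) = T i f + T i g" for f g
      unfolding T_def plus_bcontfun.rep_eq using int by simp
    show "T i (r *\<^sub>R f) = r *\<^sub>R T i f" for r f
      unfolding T_def scaleR_bcontfun.rep_eq by (simp add: algebra_simps)
    show "norm (T i f) \<le> norm f * bv_norm (G i)" for f
      unfolding T_def real_norm_def
      by (rule abs_integral_le_bv_norm[OF K meas nb step_approximable_continuous[OF K] M bv]) simp
  qed
  have "\<exists>C. \<forall>i. \<bar>T i f\<bar> \<le> C" for f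
    unfolding T_def by (intro fam_lim0_bounded null) simp
  then obtain C where C: "\<And>i f. \<bar>T i f\<bar> \<le> C * norm f" using banach_steinhaus_real[OF complete_UNIV_bcontfun, of T] lin by blast
  have "bv_norm (G i) \<le> \<bar>C\<bar>" for i
  proof (rule bv_norm_le_functional[OF K M])
    fix f :: "'a \<Rightarrow> real" assume f: "continuous_on UNIV f" "\<And>x. \<bar>f x\<bar> \<le> 1"
    then have "f \<in> bcontfun" by (auto simp: bcontfun_def bounded_iff)
    then obtain g where g: "f = apply_bcontfun g" by (rule bcontfunE)
    have "norm g \<le> 1" using f(2) unfolding g by (intro norm_bound) simp
    then have "C * norm g \<le> \<bar>C\<bar> * 1" by (intro mult_mono) auto
    then show "\<bar>integral\<^sup>L (M1 i) f - integral\<^sup>L (M2 i) f\<bar> \<le> \<bar>C\<bar>"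
      using C[of i g] unfolding T_def g by simp
  qed
  then show ?thesis by blast
qed

section \<open>Fibres, and necessity of the condition\<close>

definition fibre_min :: "('k::linorder \<Rightarrow> 'l) \<Rightarrow> 'l \<Rightarrow> 'k" where
  "fibre_min \<phi> t = (LEAST x. \<phi> x = t)"

definition fibre_max :: "('k::linorder \<Rightarrow> 'l) \<Rightarrow> 'l \<Rightarrow> 'k" where
  "fibre_max \<phi> t = (GREATEST x. \<phi> x = t)"

text \<open>A fibre is compact and nonempty, so its least and greatest points exist. The two
  equivalences between inequalities say that \<open>fibre_max\<close> and \<open>fibre_min\<close>
  are the right and left adjoints of \<open>\<phi>\<close>; the description of a fibre as an
  interval follows from them.\<close>

lemma fibre_bounds:
  fixes \<phi> :: "'k::linorder_topology \<Rightarrow> 'l::linorder_topology"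
  assumes K: "compact (UNIV :: 'k set)" and \<phi>: "continuous_on UNIV \<phi>" "mono \<phi>" "surj \<phi>"
  shows "\<phi> (fibre_min \<phi> t) = t" "\<phi> (fibre_max \<phi> t) = t"
    "\<phi> x = t \<longleftrightarrow> fibre_min \<phi> t \<le> x \<and> x \<le> fibre_max \<phi> t"
    "\<phi> x \<le> t \<longleftrightarrow> x \<le> fibre_max \<phi> t" "t \<le> \<phi> x \<longleftrightarrow> fibre_min \<phi> t \<le> x"
    "fibre_min \<phi> t \<le> fibre_max \<phi> t" "t \<in> Qset \<phi> \<longleftrightarrow> fibre_min \<phi> t < fibre_max \<phi> t"
proof -
  have "compact (\<phi> -` {t})"
    using compact_Int_closed[OF K continuous_closed_vimage[of "{t}" \<phi>]] \<phi>(1)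
    by (simp add: continuous_on_eq_continuous_at)
  moreover have "\<phi> -` {t} \<noteq> {}" using \<phi>(3) by (metis surjD vimage_singleton_eq empty_iff)
  ultimately have c: "\<exists>s\<in>\<phi> -` {t}. \<forall>x\<in>\<phi> -` {t}. s \<le> x" "\<exists>s\<in>\<phi> -` {t}. \<forall>x\<in>\<phi> -` {t}. x \<le> s"
    by (rule compact_attains_inf compact_attains_sup)+
  obtain u where u: "\<phi> u = t" "\<And>x. \<phi> x = t \<Longrightarrow> u \<le> x" using c(1) by auto
  obtain v where v: "\<phi> v = t" "\<And>x. \<phi> x = t \<Longrightarrow> x \<le> v" using c(2) by auto
  have fu: "fibre_min \<phi> t = u" unfolding fibre_min_def by (rule Least_equality) (use u in auto)
  have fv: "fibre_max \<phi> t = v" unfolding fibre_max_def by (rule Greatest_equality) (use v in auto)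
  show 1: "\<phi> (fibre_min \<phi> t) = t" "\<phi> (fibre_max \<phi> t) = t" using fu fv u v by auto
  show 3: "\<phi> x \<le> t \<longleftrightarrow> x \<le> fibre_max \<phi> t" for x
    unfolding fv using v monoD[OF \<phi>(2), of x v] monoD[OF \<phi>(2), of v x] by (metis antisym linorder_linear)
  show 4: "t \<le> \<phi> x \<longleftrightarrow> fibre_min \<phi> t \<le> x" for x
    unfolding fu using u monoD[OF \<phi>(2), of x u] monoD[OF \<phi>(2), of u x] by (metis antisym linorder_linear)
  show 2: "\<phi> x = t \<longleftrightarrow> fibre_min \<phi> t \<le> x \<and> x \<le> fibre_max \<phi> t" for x
    using 3 4 by (metis order.eq_iff)
  show "fibre_min \<phi> t \<le> fibre_max \<phi> t" using 1 4 by (metis order_refl)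
  then show "t \<in> Qset \<phi> \<longleftrightarrow> fibre_min \<phi> t < fibre_max \<phi> t"
    unfolding Qset_def mem_Collect_eq 2 by (metis antisym order.strict_iff_order order_trans order_refl)
qed

text \<open>Finite sums of \<open>\<bar>b i t\<bar>\<close> are bounded by integrating one function
  \<open>h\<close>, a signed sum of functions living on the intervals (u, v]. It need not be
  continuous, so weak* convergence says nothing about it; the uniform bound on the norms
  does.\<close>

lemma c0l1_over_of_extends_through:
  fixes \<phi> :: "'k::linorder_topology \<Rightarrow> 'l::linorder_topology" and G :: "'i \<Rightarrow> 'k \<Rightarrow> real"
  assumes K: "compact (UNIV :: 'k set)" and \<phi>: "continuous_on UNIV \<phi>" "mono \<phi>" "surj \<phi>"
    and G: "weak_star_null_NBV G" "\<And>i. phi_star \<phi> (G i) = F i"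
  shows "c0l1_over (Qset \<phi>) F"
proof -
  note fib = fibre_bounds[OF K \<phi>]
  let ?u = "fibre_min \<phi>" and ?v = "fibre_max \<phi>"
  have FG: "F i t = G i (?v t)" for i t
    unfolding G(2)[symmetric] by (simp add: phi_star_def fibre_max_def)
  obtain M1 M2 where M: "\<And>i. associated_measure (G i) (M1 i) (M2 i)"
    and null: "\<And>f :: 'k \<Rightarrow> real. continuous_on UNIV f \<Longrightarrow> fam_lim0 (\<lambda>i. integral\<^sup>L (M1 i) f - integral\<^sup>L (M2 i) f)"
    using G unfolding weak_star_null_NBV_def by blast
  have bv: "bounded_variation (G i)" for i
    using G by (auto simp: weak_star_null_NBV_def NBV_def)
  note D = associated_measureD[OF K M]
  obtain C where C: "\<And>i. bv_norm (G i) \<le> C" using weak_star_null_bounded[OF K G(1)] by blast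
  \<comment> \<open>The cutoff depends on \<open>t\<close> only, not on \<open>i\<close>, so that
    for fixed \<open>t\<close> the numbers \<open>a i t\<close> are integrals of one and the same
    continuous function.\<close>
  have "\<exists>f. \<forall>t. t \<in> Qset \<phi> \<longrightarrow> continuous_on UNIV (f t) \<and> (\<forall>y. 0 \<le> f t y \<and> f t y \<le> (1::real)) \<and>
     (\<forall>y\<le>?u t. f t y = 1) \<and> (\<forall>y\<ge>?v t. f t y = 0)"
  proof (rule choice, rule allI)
    fix t
    show "\<exists>f. t \<in> Qset \<phi> \<longrightarrow> continuous_on UNIV f \<and> (\<forall>y. 0 \<le> f y \<and> f y \<le> (1::real)) \<and>
      (\<forall>y\<le>?u t. f y = 1) \<and> (\<forall>y\<ge>?v t. f y = 0)"
    proof (cases "?u t < ?v t")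
      case True
      then show ?thesis using continuous_cutoff_between[OF K True] by blast
    qed (simp add: fib(7))
  qed
  then obtain f where f0: "\<forall>t. t \<in> Qset \<phi> \<longrightarrow> continuous_on UNIV (f t) \<and> (\<forall>y. 0 \<le> f t y \<and> f t y \<le> (1::real)) \<and>
     (\<forall>y\<le>?u t. f t y = 1) \<and> (\<forall>y\<ge>?v t. f t y = 0)" ..
  have f: "\<And>t. t \<in> Qset \<phi> \<Longrightarrow> continuous_on UNIV (f t)"
    "\<And>t y. t \<in> Qset \<phi> \<Longrightarrow> 0 \<le> f t y" "\<And>t y. t \<in> Qset \<phi> \<Longrightarrow> f t y \<le> 1"
    "\<And>t y. t \<in> Qset \<phi> \<Longrightarrow> y \<le> ?u t \<Longrightarrow> f t y = 1" "\<And>t y. t \<in> Qset \<phi> \<Longrightarrow> ?v t \<le> y \<Longrightarrow> f t y = 0"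
    using f0 by simp_all
  define a where "a i t = integral\<^sup>L (M1 i) (f t) - integral\<^sup>L (M2 i) (f t)" for i t
  define b where "b i t = F i t - a i t" for i t
  have fin: "(\<Sum>t\<in>T. \<bar>b i t\<bar>) \<le> C" if T: "finite T" "T \<subseteq> Qset \<phi>" for i T
  proof -
    define s where "s t = (if 0 \<le> b i t then 1 else - 1 :: real)" for t
    define h where "h x = (\<Sum>t\<in>T. s t * (indicator {..?v t} x - f t x))" for x
    \<comment> \<open>A point of another fibre lies below u, where both terms are 1, or above v,
      where both are 0. At each \<open>x\<close> at most the term with \<open>t = \<phi> x\<close>
      survives.\<close>
    have zero: "indicator {..?v t} x - f t x = 0" if "t \<in> Qset \<phi>" "t \<noteq> \<phi> x" for t x
      using that fib(3)[of x t] f(4)[of t x] f(5)[of t x] fib(7)[of t] by (auto simp: indicator_def not_le)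
    have h1: "\<bar>h x\<bar> \<le> 1" for x
    proof -
      have "h x = (\<Sum>t\<in>T. if t = \<phi> x then s (\<phi> x) * (indicator {..?v (\<phi> x)} x - f (\<phi> x) x) else 0)"
        unfolding h_def by (rule sum.cong) (use zero T in auto)
      also have "\<bar>\<dots>\<bar> \<le> 1"
        using T f(2,3)[of "\<phi> x" x] by (auto simp: s_def indicator_def)
      finally show ?thesis .
    qed
    have fm: "f t \<in> borel_measurable borel" if "t \<in> T" for t
      using f(1) T that by (auto intro: borel_measurable_continuous_onI)
    have hm: "h \<in> borel_measurable borel"
      unfolding h_def by (intro borel_measurable_sum borel_measurable_times borel_measurable_diff
          borel_measurable_const borel_measurable_indicator fm borel_sets_ray)
    have "step_approximable (\<lambda>x. s t * (indicator {..?v t} x + (- 1) * f t x))" if "t \<in> T" for t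
      using f(1) T that by (intro step_approximable_cmult step_approximable_add step_approximable_atMost
          step_approximable_continuous[OF K]) auto
    then have hs: "step_approximable h"
      unfolding h_def by (intro step_approximable_sum) simp
    have int: "integrable (M1 i) (f t)" "integrable (M2 i) (f t)" if "t \<in> T" for t
      using f(2,3)[of t] T that
      by (auto intro!: integrable_bounded_borel[OF D(1,3) fm, of _ 1] integrable_bounded_borel[OF D(2,4) fm, of _ 1])
    have int': "integrable (M1 i) (indicat_real {..x})" "integrable (M2 i) (indicat_real {..x})" for x
      by (auto intro!: integrable_bounded_borel[OF D(1,3), of _ 1] integrable_bounded_borel[OF D(2,4), of _ 1]
        borel_measurable_indicator)
    have "space (M1 i) = UNIV" "space (M2 i) = UNIV"
      using D(3,4)[of i] sets_eq_imp_space_eq[of _ borel] by auto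
    then have "integral\<^sup>L (M1 i) h - integral\<^sup>L (M2 i) h
       = (\<Sum>t\<in>T. s t * (measure (M1 i) {..?v t} - integral\<^sup>L (M1 i) (f t))) -
         (\<Sum>t\<in>T. s t * (measure (M2 i) {..?v t} - integral\<^sup>L (M2 i) (f t)))"
      unfolding h_def using int int' by (simp add: Bochner_Integration.integral_sum)
    also have "\<dots> = (\<Sum>t\<in>T. s t * b i t)"
      unfolding sum_subtractf[symmetric] b_def a_def FG D(5) by (rule sum.cong) (auto simp: algebra_simps)
    also have "\<dots> = (\<Sum>t\<in>T. \<bar>b i t\<bar>)" by (rule sum.cong) (auto simp: s_def)
    finally have "(\<Sum>t\<in>T. \<bar>b i t\<bar>) \<le> 1 * bv_norm (G i)"
      using abs_integral_le_bv_norm[OF K hm h1 hs M bv, of i] by linarith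
    then show ?thesis using C[of i] by simp
  qed
  have "c0l1_bounded_over (Qset \<phi>) F (\<lambda>_. C)"
    unfolding c0l1_bounded_over_def
  proof (rule exI[of _ a], rule exI[of _ b], intro conjI allI ballI)
    show "F i t = a i t + b i t" for i t by (simp add: b_def)
    show "fam_lim0 (\<lambda>i. a i t)" if "t \<in> Qset \<phi>" for t unfolding a_def by (rule null[OF f(1)[OF that]])
    fix i
    show sm: "(\<lambda>t. \<bar>b i t\<bar>) summable_on Qset \<phi>"
      by (rule nonneg_bdd_above_summable_on) (auto intro!: bdd_aboveI[of _ C] fin)
    show "(\<Sum>\<^sub>\<infinity>t\<in>Qset \<phi>. \<bar>b i t\<bar>) \<le> C"
      by (rule infsum_le_finite_sums[OF sm]) (rule fin)
  qed
  then show ?thesis unfolding c0l1_over_def by blast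
qed

section \<open>Measures with a given distribution function\<close>

text \<open>The sets that lie between a closed and an open set differing by little in measure form a
  \<sigma>-algebra. It contains the open sets by assumption, and closed sets are compact here. An
  argument is needed because a finite Borel measure on a compact line can fail to be regular, as the
  Dieudonne measure on the ordinals up to \<omega>_1 does.\<close>

lemma regular_finite_borelI:
  fixes M :: "'a::t2_space measure"
  assumes K: "compact (UNIV :: 'a set)" and M: "finite_measure M" "sets M = sets borel"
    and inner: "\<And>U e. open U \<Longrightarrow> 0 < e \<Longrightarrow> \<exists>C. compact C \<and> C \<subseteq> U \<and> measure M U < measure M C + e"
  shows "regular_finite_borel M"
proof -
  interpret finite_measure M by fact
  have sp: "space M = UNIV" using sets_eq_imp_space_eq[OF M(2)] by simp
  define P where "P A e \<longleftrightarrow> (\<exists>C U. closed C \<and> open U \<and> C \<subseteq> A \<and> A \<subseteq> U \<and> measure M (U - C) < e)" for A and e :: real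
  have [simp]: "open A \<Longrightarrow> A \<in> sets M" "closed A \<Longrightarrow> A \<in> sets M" for A by (auto simp: M)
  have approx: "A \<in> sets borel \<and> (\<forall>e>0. P A e)" if "A \<in> sigma_sets UNIV {S. open S}" for A
    using that
  proof (induction rule: sigma_sets.induct)
    case (Basic U)
    then have U: "open U" by simp
    have "P U e" if e: "e > 0" for e
    proof -
      obtain C where C: "compact C" "C \<subseteq> U" "measure M U < measure M C + e" using inner[OF U e] by blast
      have cl: "closed C" using C by (simp add: compact_imp_closed)
      then have "measure M (U - C) = measure M U - measure M C"
        using C U by (intro finite_measure_Diff) auto
      then show ?thesis unfolding P_def using C U cl by (intro exI[of _ C] exI[of _ U]) auto
    qed
    then show ?case using U by auto
  next
    case Empty
    have "P {} e" if "e > 0" for e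
      unfolding P_def using that by (intro exI[of _ "{}"]) auto
    then show ?case by simp
  next
    case (Compl A)
    have "P (UNIV - A) e" if e: "e > 0" for e
    proof -
      obtain C U where C: "closed C" "open U" "C \<subseteq> A" "A \<subseteq> U" "measure M (U - C) < e"
        using Compl.IH e unfolding P_def by blast
      moreover have "(- C) - (- U) = U - C" by auto
      ultimately show ?thesis unfolding P_def
        by (intro exI[of _ "- U"] exI[of _ "- C"]) auto
    qed
    then show ?case using Compl.IH by auto
  next
    case (Union A)
    have "P (\<Union>n. A n) e" if e: "e > 0" for e
    proof -
      \<comment> \<open>Half of \<open>e\<close> is spent on the gaps
        \<open>snd (p n) - fst (p n)\<close> of all \<open>n\<close> together, the other half on
        cutting the union of the closed sets down to a finite one.\<close>
      define d where "d n = (e / 2) * (1 / 2) ^ Suc n" for n :: nat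
      have d: "d n > 0" for n using e by (simp add: d_def)
      have ds: "d sums (e / 2)" unfolding d_def using sums_mult[OF power_half_series, of "e / 2"] by simp
      have "\<forall>n. \<exists>p. closed (fst p) \<and> open (snd p) \<and> fst p \<subseteq> A n \<and> A n \<subseteq> snd p \<and> measure M (snd p - fst p) < d n"
        using Union.IH d unfolding P_def by (metis fst_conv snd_conv)
      from choice[OF this] obtain p where p: "\<And>n. closed (fst (p n))" "\<And>n. open (snd (p n))"
        "\<And>n. fst (p n) \<subseteq> A n" "\<And>n. A n \<subseteq> snd (p n)" "\<And>n. measure M (snd (p n) - fst (p n)) < d n"
        by blast
      define U where "U = (\<Union>n. snd (p n))"
      define D where "D = (\<Union>n. fst (p n))"
      \<comment> \<open>\<open>D\<close> need not be closed; the finite unions \<open>C N\<close>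
        are, and they increase to \<open>D\<close>.\<close>
      define C where "C N = (\<Union>n\<le>N. fst (p n))" for N :: nat
      have oU: "open U" and cC: "closed (C N)" for N
        unfolding U_def C_def using p by auto
      have Dm: "D \<in> sets M" unfolding D_def using p by auto
      have "measure M (U - D) \<le> e / 2"
      proof -
        have sm: "summable (\<lambda>n. measure M (snd (p n) - fst (p n)))"
          by (rule summable_comparison_test'[OF sums_summable[OF ds], of 0]) (use p(5) in \<open>auto intro: less_imp_le\<close>)
        have "measure M (U - D) \<le> measure M (\<Union>n. snd (p n) - fst (p n))"
          using p by (intro finite_measure_mono sets.countable_UN sets.Diff) (auto simp: U_def D_def)
        also have "\<dots> \<le> (\<Sum>n. measure M (snd (p n) - fst (p n)))"
          using p by (intro finite_measure_subadditive_countably sm) auto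
        also have "\<dots> \<le> suminf d"
          by (intro suminf_le sm sums_summable[OF ds] less_imp_le p)
        also have "\<dots> = e / 2" using ds by (simp add: sums_iff)
        finally show ?thesis .
      qed
      moreover have "\<exists>N. measure M D - measure M (C N) < e / 2"
      proof -
        have "(\<lambda>N. measure M (C N)) \<longlonglongrightarrow> measure M (\<Union>N. C N)"
        proof (rule finite_Lim_measure_incseq)
          show "incseq C" unfolding incseq_def C_def by (intro allI impI UN_mono) auto
        qed (use cC in auto)
        moreover have "(\<Union>N. C N) = D" unfolding C_def D_def by auto
        ultimately have "\<forall>\<^sub>F N in sequentially. measure M D - e / 2 < measure M (C N)"
          using e by (intro order_tendstoD(1)) auto
        then obtain N where "measure M D - e / 2 < measure M (C N)"
          using eventually_happens'[OF sequentially_bot] by blast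
        then show ?thesis by (intro exI[of _ N]) simp
      qed
      then obtain N where N: "measure M D - measure M (C N) < e / 2" ..
      moreover have "measure M (U - C N) \<le> measure M (U - D) + measure M (D - C N)"
      proof -
        have "measure M (U - C N) \<le> measure M ((U - D) \<union> (D - C N))"
          using oU Dm cC by (intro finite_measure_mono sets.Un sets.Diff) auto
        also have "\<dots> \<le> measure M (U - D) + measure M (D - C N)"
          using oU Dm cC by (intro measure_Un_le sets.Diff) auto
        finally show ?thesis .
      qed
      moreover have "measure M (D - C N) = measure M D - measure M (C N)"
        using Dm cC by (intro finite_measure_Diff) (auto simp: C_def D_def)
      ultimately have "measure M (U - C N) < e" by linarith
      moreover have "C N \<subseteq> (\<Union>n. A n)" unfolding C_def using p(3) by (intro UN_mono) auto
      moreover have "(\<Union>n. A n) \<subseteq> U" unfolding U_def using p(4) by (intro UN_mono) auto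
      ultimately show ?thesis unfolding P_def
        using oU cC[of N] by - (rule exI[of _ "C N"], rule exI[of _ U], simp)
    qed
    then show ?case using Union.IH by auto
  qed
  have "measure M A = (INF U \<in> {U. open U \<and> A \<subseteq> U}. measure M U) \<and>
        measure M A = (SUP C \<in> {C. compact C \<and> C \<subseteq> A}. measure M C)" if A: "A \<in> sets borel" for A
  proof -
    have ap: "\<exists>C U. closed C \<and> open U \<and> C \<subseteq> A \<and> A \<subseteq> U \<and> measure M (U - C) < e" if "e > 0" for e
      using approx[of A] A that unfolding P_def sets_borel by simp
    have bb: "bdd_below (measure M ` X)" "bdd_above (measure M ` X)" for X
      by (auto intro!: bdd_belowI[of _ 0] bdd_aboveI[of _ "measure M (space M)"] bounded_measure)
    have Am: "A \<in> sets M" using A M by simp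
    have "(INF U \<in> {U. open U \<and> A \<subseteq> U}. measure M U) \<le> measure M A"
    proof (rule field_le_epsilon)
      fix e :: real assume "e > 0"
      from ap[OF this] obtain C U where C: "closed C" "open U" "C \<subseteq> A" "A \<subseteq> U" "measure M (U - C) < e"
        by (elim exE conjE)
      have "(INF U \<in> {U. open U \<and> A \<subseteq> U}. measure M U) \<le> measure M U"
        using C by (intro cINF_lower bb) auto
      also have "\<dots> \<le> measure M (A \<union> (U - C))"
        using C Am by (intro finite_measure_mono sets.Un sets.Diff) auto
      also have "\<dots> \<le> measure M A + measure M (U - C)"
        using C Am by (intro measure_Un_le sets.Diff) auto
      finally show "(INF U \<in> {U. open U \<and> A \<subseteq> U}. measure M U) \<le> measure M A + e" using C by linarith
    qed
    moreover have "measure M A \<le> (INF U \<in> {U. open U \<and> A \<subseteq> U}. measure M U)"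
      using Am by (intro cINF_greatest finite_measure_mono) auto
    moreover have "measure M A \<le> (SUP C \<in> {C. compact C \<and> C \<subseteq> A}. measure M C)"
    proof (rule field_le_epsilon)
      fix e :: real assume "e > 0"
      from ap[OF this] obtain C U where C: "closed C" "open U" "C \<subseteq> A" "A \<subseteq> U" "measure M (U - C) < e"
        by (elim exE conjE)
      have "measure M A \<le> measure M (C \<union> (U - C))"
        using C Am by (intro finite_measure_mono sets.Un sets.Diff) auto
      also have "\<dots> \<le> measure M C + measure M (U - C)"
        using C Am by (intro measure_Un_le sets.Diff) auto
      also have "measure M C \<le> (SUP C \<in> {C. compact C \<and> C \<subseteq> A}. measure M C)"
        using C compact_Int_closed[OF K, of C] by (intro cSUP_upper bb) auto
      finally show "measure M A \<le> (SUP C \<in> {C. compact C \<and> C \<subseteq> A}. measure M C) + e" using C by linarith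
    qed
    moreover have "(SUP C \<in> {C. compact C \<and> C \<subseteq> A}. measure M C) \<le> measure M A"
      using Am by (intro cSUP_least finite_measure_mono) (auto intro: exI[of _ "{}"])
    ultimately show ?thesis by (intro conjI antisym) auto
  qed
  then show ?thesis unfolding regular_finite_borel_def using M by blast
qed

text \<open>If \<open>s\<close> is not the greatest element, a rational between \<open>s\<close> and
  a larger element of \<open>S\<close> selects an element above \<open>s\<close>; \<open>T\<close>
  supplies the greatest element if there is one.\<close>

lemma countable_cofinal_real:
  fixes S :: "real set"
  shows "\<exists>Y. countable Y \<and> Y \<subseteq> S \<and> (\<forall>s\<in>S. \<exists>y\<in>Y. s \<le> y)"
proof -
  define R where "R = {r \<in> \<rat>. \<exists>s\<in>S. r < s}"
  define f where "f r = (SOME s. s \<in> S \<and> r < s)" for r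
  define T where "T = {x \<in> S. \<forall>s\<in>S. s \<le> x}"
  have f: "f r \<in> S \<and> r < f r" if "r \<in> R" for r
    unfolding f_def by (rule someI_ex) (use that in \<open>auto simp: R_def\<close>)
  have "T \<subseteq> {x}" if "x \<in> T" for x using that unfolding T_def by (auto intro: antisym)
  then obtain x where "T \<subseteq> {x}" by blast
  then have "countable T" by (rule countable_subset) simp
  moreover have "countable R" unfolding R_def by (rule countable_subset[OF _ countable_rat]) auto
  moreover have "\<exists>y\<in>f ` R \<union> T. s \<le> y" if s: "s \<in> S" for s
  proof (cases "s \<in> T")
    case False
    then obtain s' where "s' \<in> S" "s < s'" using s unfolding T_def by (auto simp: not_le)
    moreover obtain r where "r \<in> \<rat>" "s < r" "r < s'" using Rats_dense_in_real[OF \<open>s < s'\<close>] by blast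
    ultimately have "r \<in> R" unfolding R_def by blast
    then show ?thesis using f[of r] \<open>s < r\<close> by (intro bexI[of _ "f r"]) auto
  qed auto
  ultimately show ?thesis using f by (intro exI[of _ "f ` R \<union> T"]) (auto simp: T_def)
qed

text \<open>For increasing functions this is right-continuity, but in a form that is visibly stable under
  composition with continuous maps.\<close>
definition usc :: "('a::topological_space \<Rightarrow> real) \<Rightarrow> bool" where
  "usc H \<longleftrightarrow> (\<forall>t. \<forall>e>0. eventually (\<lambda>s. H s < H t + e) (nhds t))"

text \<open>The measure is the image of Lebesgue measure on (0, c], c the maximum of H, under the
  generalized inverse of H.\<close>
lemma exists_regular_measure_mono:
  fixes H :: "'a::linorder_topology \<Rightarrow> real"
  assumes K: "compact (UNIV :: 'a set)" and H: "mono H" "\<And>t. 0 \<le> H t" "usc H"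
  shows "\<exists>M. regular_finite_borel M \<and> (\<forall>t. measure M {..t} = H t)"
proof -
  obtain m where m: "\<And>y::'a. y \<le> m" using ex_line_max[OF K] by blast
  define c where "c = H m"
  have Hc: "H t \<le> c" for t unfolding c_def by (rule monoD[OF H(1) m])
  define \<tau> where "\<tau> y = (LEAST x. y \<le> H x)" for y
  \<comment> \<open>A Galois connection: upper semicontinuity makes \<open>{x. y \<le> H x}\<close>
    closed, compactness gives it a least point, and \<open>y \<le> c\<close> keeps it
    nonempty.\<close>
  have gal: "\<tau> y \<le> x \<longleftrightarrow> y \<le> H x" if "y \<le> c" for x y
  proof -
    have "open {x. H x < y}"
      unfolding open_subopen[of "{x. H x < y}"]
    proof
      fix t assume "t \<in> {x. H x < y}"
      then have "0 < y - H t" by simp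
      then have "eventually (\<lambda>s. H s < H t + (y - H t)) (nhds t)" using H(3) unfolding usc_def by blast
      then show "\<exists>T. open T \<and> t \<in> T \<and> T \<subseteq> {x. H x < y}" by (auto simp: eventually_nhds)
    qed
    then have "closed {x. y \<le> H x}" unfolding closed_def by (simp add: Collect_neg_eq[symmetric] not_le)
    then have "compact {x. y \<le> H x}" using compact_Int_closed[OF K] by fastforce
    moreover have "m \<in> {x. y \<le> H x}" using that by (simp add: c_def)
    ultimately obtain x0 where x0: "y \<le> H x0" "\<And>x. y \<le> H x \<Longrightarrow> x0 \<le> x"
      using compact_attains_inf[of "{x. y \<le> H x}"] by blast
    have "\<tau> y = x0" unfolding \<tau>_def by (rule Least_equality) (use x0 in auto)
    then show ?thesis using x0 monoD[OF H(1), of x0 x] by auto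
  qed
  define S where "S = {0<..c}"
  have mono\<tau>: "\<tau> y \<le> \<tau> z" if "y \<le> z" "z \<le> c" for y z
    using gal[of y "\<tau> z"] gal[of z "\<tau> z"] that by simp
  \<comment> \<open>Since rays need not generate the Borel sets, measurability has to be checked on
    arbitrary open sets. The inclusion of the hulls \<open>{\<tau> q..\<tau> y}\<close> in
    \<open>U\<close> will moreover provide the compact sets for inner regularity.\<close>
  have decomp: "\<exists>I. countable I \<and> \<tau> -` U \<inter> S = (\<Union>(q, y)\<in>I. {q..y}) \<and> (\<forall>(q, y)\<in>I. {\<tau> q..\<tau> y} \<subseteq> U)"
    if U: "open U" for U
  proof -
    define B where "B = \<tau> -` U \<inter> S"
    define S' where "S' q = {y \<in> B. q \<le> y \<and> {\<tau> q..\<tau> y} \<subseteq> U}" for q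
    have "\<exists>Y. \<forall>q. countable (Y q) \<and> Y q \<subseteq> S' q \<and> (\<forall>s\<in>S' q. \<exists>y\<in>Y q. s \<le> y)"
      by (rule choice, rule allI, rule countable_cofinal_real)
    then obtain Y where Y0: "\<forall>q. countable (Y q) \<and> Y q \<subseteq> S' q \<and> (\<forall>s\<in>S' q. \<exists>y\<in>Y q. s \<le> y)" ..
    then have Y: "\<And>q. countable (Y q)" "\<And>q. Y q \<subseteq> S' q" "\<And>q s. s \<in> S' q \<Longrightarrow> \<exists>y\<in>Y q. s \<le> y"
      by blast+
    \<comment> \<open>Left ends range over the positive rationals, and for each of them a countable
      cofinal set of admissible right ends is enough.\<close>
    define I where "I = Sigma (\<rat> \<inter> {0<..}) Y"
    have "countable I" unfolding I_def using Y(1) countable_rat by (intro countable_SIGMA) (auto intro: countable_subset)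
    moreover have "\<forall>(q, y)\<in>I. {\<tau> q..\<tau> y} \<subseteq> U" using Y(2) unfolding I_def S'_def by blast
    moreover have "B \<subseteq> (\<Union>(q, y)\<in>I. {q..y})"
    proof
      fix y assume y: "y \<in> B"
      then have yU: "\<tau> y \<in> U" "0 < y" "y \<le> c" by (auto simp: B_def S_def)
      \<comment> \<open>Every \<open>q\<close> between the threshold \<open>g\<close> and
        \<open>y\<close> gives a hull inside \<open>U\<close>. For a point
        \<open>a < \<tau> y\<close> with \<open>{a<..\<tau> y} \<subseteq> U\<close> the threshold
        is \<open>H a\<close>, since \<open>H a < q\<close> means \<open>a < \<tau> q\<close>. If
        \<open>\<tau> y\<close> is the least point, 0 will do.\<close>
      have "\<exists>g\<ge>0. g < y \<and> (\<forall>q. g < q \<longrightarrow> q \<le> y \<longrightarrow> {\<tau> q..\<tau> y} \<subseteq> U)"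
      proof (cases "\<exists>a. a < \<tau> y")
        case True
        then obtain a where a: "a < \<tau> y" "{a<..\<tau> y} \<subseteq> U" using open_left[OF U yU(1)] by blast
        then have "H a < y" using gal[OF yU(3), of a] by auto
        moreover have "{\<tau> q..\<tau> y} \<subseteq> U" if "H a < q" "q \<le> y" for q
          using gal[of q a] that yU a by (auto simp: subset_eq)
        ultimately show ?thesis using H(2)[of a] by blast
      next
        case False
        then have "x = \<tau> y" if "x \<le> \<tau> y" for x using that by (simp add: not_less antisym)
        then have "{\<tau> q..\<tau> y} \<subseteq> {\<tau> y}" for q by (simp add: subset_eq)
        then have "{\<tau> q..\<tau> y} \<subseteq> U" for q using yU by blast
        then show ?thesis using yU by (intro exI[of _ 0]) auto
      qed
      then obtain g where g: "0 \<le> g" "g < y" "\<And>q. g < q \<Longrightarrow> q \<le> y \<Longrightarrow> {\<tau> q..\<tau> y} \<subseteq> U" by blast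
      obtain q where q: "q \<in> \<rat>" "g < q" "q < y" using Rats_dense_in_real[OF g(2)] by blast
      then have "y \<in> S' q" using g(3)[of q] y by (auto simp: S'_def)
      then obtain y' where "y' \<in> Y q" "y \<le> y'" using Y(3) by blast
      then show "y \<in> (\<Union>(q, y)\<in>I. {q..y})" using q g(1) unfolding I_def by (intro UN_I[of "(q, y')"]) auto
    qed
    moreover have "(\<Union>(q, y)\<in>I. {q..y}) \<subseteq> B"
    proof clarsimp
      fix q y z assume qy: "(q, y) \<in> I" and z: "q \<le> z" "z \<le> y"
      then have *: "0 < q" "y \<in> S" "{\<tau> q..\<tau> y} \<subseteq> U" using Y(2)[of q] by (auto simp: I_def S'_def B_def)
      then have "\<tau> z \<in> {\<tau> q..\<tau> y}" using z by (auto simp: S_def intro!: mono\<tau>)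
      then show "z \<in> B" using * z by (auto simp: B_def S_def)
    qed
    ultimately show ?thesis unfolding B_def by (intro exI[of _ I]) blast
  qed
  define N where "N = restrict_space lborel S"
  have spN: "space N = S" by (simp add: N_def space_restrict_space)
  have setsN: "A \<in> sets N \<longleftrightarrow> A \<in> sets borel \<and> A \<subseteq> S" for A
    unfolding N_def by (subst sets_restrict_space_iff) (auto simp: S_def)
  have "emeasure N S = emeasure lborel S" unfolding N_def by (rule emeasure_restrict_space) (auto simp: S_def)
  then have "emeasure N (space N) \<noteq> \<infinity>" unfolding spN using H(2)[of m] by (simp add: S_def c_def)
  then interpret N: finite_measure N by (rule finite_measureI)
  have \<tau>m: "\<tau> \<in> measurable N borel"
  proof (rule borel_measurableI)
    fix U :: "'a set" assume "open U"
    from decomp[OF this] obtain I where I: "countable I" "\<tau> -` U \<inter> S = (\<Union>(q, y)\<in>I. {q..y})"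
      by (elim exE conjE)
    have "(\<Union>(q, y)\<in>I. {q..y}) \<in> sets borel" using I(1) by (intro sets.countable_UN'') auto
    then show "\<tau> -` U \<inter> space N \<in> sets N" unfolding spN setsN I(2)[symmetric] by auto
  qed
  define M where "M = distr N borel \<tau>"
  have setsM: "sets M = sets borel" by (simp add: M_def)
  interpret M: finite_measure M unfolding M_def by (rule N.finite_measure_distr[OF \<tau>m])
  have meas: "measure M A = measure N (\<tau> -` A \<inter> S)" if "A \<in> sets borel" for A
    unfolding M_def using measure_distr[OF \<tau>m that] spN by simp
  have "regular_finite_borel M"
  proof (rule regular_finite_borelI[OF K _ setsM])
    show "finite_measure M" by unfold_locales
    fix U :: "'a set" and e :: real assume U: "open U" and e: "0 < e"
    from decomp[OF U] obtain I where I: "countable I" "\<tau> -` U \<inter> S = (\<Union>(q, y)\<in>I. {q..y})"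
      "\<forall>(q, y)\<in>I. {\<tau> q..\<tau> y} \<subseteq> U"
      by (elim exE conjE)
    show "\<exists>C. compact C \<and> C \<subseteq> U \<and> measure M U < measure M C + e"
    proof (cases "I = {}")
      case True
      then have "measure M U = 0" using meas[of U] U I(2) by simp
      then show ?thesis using e by (intro exI[of _ "{}"]) auto
    next
      case False
      define p where "p = from_nat_into I"
      have pI: "p n \<in> I" for n unfolding p_def by (rule from_nat_into[OF False])
      define A where "A n = {fst (p n)..snd (p n)}" for n
      have AS: "A n \<subseteq> S" for n using I(2) pI[of n] unfolding A_def by (force simp: case_prod_beta)
      have UA: "(\<Union>n. A n) = \<tau> -` U \<inter> S"
      proof -
        have "(\<Union>n. A n) = (\<Union>i\<in>range p. {fst i..snd i})" by (simp add: A_def)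
        also have "range p = I" unfolding p_def using range_from_nat_into[OF False I(1)] .
        finally show ?thesis unfolding I(2) by (simp add: case_prod_beta)
      qed
      define B where "B n = (\<Union>k\<le>n. A k)" for n
      have Bs: "B n \<in> sets N" for n unfolding setsN B_def using AS by (auto simp: A_def)
      have "(\<lambda>n. measure N (B n)) \<longlonglongrightarrow> measure N (\<Union>n. B n)"
      proof (rule N.finite_Lim_measure_incseq)
        show "incseq B" unfolding incseq_def B_def by (intro allI impI UN_mono) auto
      qed (use Bs in auto)
      moreover have "(\<Union>n. B n) = \<tau> -` U \<inter> S" unfolding UA[symmetric] B_def by auto
      ultimately have "\<forall>\<^sub>F n in sequentially. measure M U - e < measure N (B n)"
        using e meas[of U] U by (intro order_tendstoD(1)) auto
      then obtain n where n: "measure M U - e < measure N (B n)"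
        using eventually_happens'[OF sequentially_bot] by blast
      \<comment> \<open>Order intervals are used rather than images under \<open>\<tau>\<close>:
        they are closed, contain the images by monotonicity, and lie in \<open>U\<close> by the
        choice of \<open>I\<close>.\<close>
      define C where "C = (\<Union>k\<le>n. {\<tau> (fst (p k))..\<tau> (snd (p k))})"
      have cl: "closed C" unfolding C_def by (intro closed_UN) auto
      have "B n \<subseteq> \<tau> -` C \<inter> S"
      proof
        fix z assume z: "z \<in> B n"
        then obtain k where k: "k \<le> n" "z \<in> A k" unfolding B_def by blast
        have "snd (p k) \<in> A k" using k(2) by (auto simp: A_def)
        then have "snd (p k) \<in> S" "z \<in> S" using AS k by blast+
        then have "snd (p k) \<le> c" "z \<in> S" by (auto simp: S_def)
        then show "z \<in> \<tau> -` C \<inter> S" using k mono\<tau>[of "fst (p k)" z] mono\<tau>[of z "snd (p k)"]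
          by (auto simp: A_def C_def S_def intro!: bexI[of _ k])
      qed
      then have "measure N (B n) \<le> measure M C"
        unfolding meas[OF borel_closed[OF cl]]
        using measurable_sets[OF \<tau>m borel_closed[OF cl]] unfolding spN by (intro N.finite_measure_mono) auto
      moreover have "C \<subseteq> U" unfolding C_def using I(3) pI by (intro UN_least) (auto simp: case_prod_beta)
      moreover have "compact C" using compact_Int_closed[OF K cl] by simp
      ultimately show ?thesis using n by (intro exI[of _ C]) auto
    qed
  qed
  moreover have "measure M {..t} = H t" for t
  proof -
    \<comment> \<open>By the Galois connection \<open>\<tau> y \<le> t\<close> means
      \<open>y \<le> H t\<close>.\<close>
    have "\<tau> -` {..t} \<inter> S = {0<..H t}" using Hc[of t] gal by (auto simp: S_def)
    then have "measure M {..t} = measure N {0<..H t}" using meas by simp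
    also have "\<dots> = measure lborel {0<..H t}" unfolding N_def
      using Hc[of t] by (intro measure_restrict_space) (auto simp: S_def)
    also have "\<dots> = H t" using H(2)[of t] by simp
    finally show ?thesis .
  qed
  ultimately show ?thesis by blast
qed

section \<open>Upper semicontinuous building blocks for distribution functions\<close>

lemma usc_comp: "usc H \<Longrightarrow> continuous_on UNIV \<phi> \<Longrightarrow> usc (\<lambda>x. H (\<phi> x))"
  unfolding usc_def
proof (intro allI impI)
  fix t and e :: real assume H: "\<forall>t. \<forall>e>0. eventually (\<lambda>s. H s < H t + e) (nhds t)"
    and \<phi>: "continuous_on UNIV \<phi>" and e: "0 < e"
  have "filterlim \<phi> (nhds (\<phi> t)) (nhds t)"
    using \<phi> by (simp add: continuous_on_def flip: tendsto_at_iff_tendsto_nhds)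
  moreover have "eventually (\<lambda>s. H s < H (\<phi> t) + e) (nhds (\<phi> t))" using H e by blast
  ultimately show "eventually (\<lambda>s. H (\<phi> s) < H (\<phi> t) + e) (nhds t)"
    by (rule eventually_compose_filterlim[rotated])
qed

lemma usc_add:
  assumes "usc G" "usc H"
  shows "usc (\<lambda>x. G x + H x)"
  unfolding usc_def
proof (intro allI impI)
  fix t and e :: real assume "e > 0"
  then have "e / 2 > 0" by simp
  then have "eventually (\<lambda>s. G s < G t + e / 2) (nhds t)" "eventually (\<lambda>s. H s < H t + e / 2) (nhds t)"
    using assms unfolding usc_def by blast+
  then show "eventually (\<lambda>s. G s + H s < G t + H t + e) (nhds t)" by eventually_elim linarith
qed

lemma mono_usc_right_continuous:
  fixes H :: "'a::linorder_topology \<Rightarrow> real"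
  assumes "mono H" "usc H"
  shows "(H \<longlongrightarrow> H t) (at_right t)"
proof (rule tendstoI)
  fix e :: real assume "e > 0"
  then have "eventually (\<lambda>s. H s < H t + e) (nhds t)" using assms unfolding usc_def by blast
  then show "eventually (\<lambda>s. dist (H s) (H t) < e) (at_right t)"
    unfolding eventually_at_filter
    by eventually_elim (use monoD[OF assms(1), of t] in \<open>auto simp: dist_real_def\<close>)
qed

lemma usc_measure_atMost:
  fixes M :: "'a::linorder_topology measure"
  assumes "regular_finite_borel M"
  shows "usc (\<lambda>t. measure M {..t})"
  unfolding usc_def
proof (intro allI impI)
  fix t and e :: real assume e: "e > 0"
  interpret finite_measure M using assms by (simp add: regular_finite_borel_def)
  have sM: "sets M = sets borel" using assms by (simp add: regular_finite_borel_def)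
  show "eventually (\<lambda>s. measure M {..s} < measure M {..t} + e) (nhds t)"
  proof (cases "\<exists>w. t < w")
    case False
    then have "{..s} \<subseteq> {..t}" for s by (auto simp: not_less)
    then have "measure M {..s} \<le> measure M {..t}" for s using sM by (intro finite_measure_mono) auto
    then show ?thesis using e by (intro always_eventually allI) (meson le_less_trans less_add_same_cancel1)
  next
    case True
    then obtain w where w: "t < w" ..
    obtain U where U: "open U" "{..t} \<subseteq> U" "measure M U < measure M {..t} + e"
      using regular_outer_approx[OF assms borel_sets_ray e] by blast
    have "t \<in> U" using U by auto
    from open_right[OF U(1) this w] obtain b where b: "t < b" "{t..<b} \<subseteq> U" by blast
    have "measure M {..s} < measure M {..t} + e" if "s < b" for s
    proof -
      have "{..s} \<subseteq> U"
      proof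
        fix x assume "x \<in> {..s}"
        then show "x \<in> U" using that b U(2) by (cases "x \<le> t") (auto dest!: subsetD[of _ U x])
      qed
      then have "measure M {..s} \<le> measure M U" using U sM by (intro finite_measure_mono) auto
      then show ?thesis using U by simp
    qed
    moreover have "eventually (\<lambda>s. s < b) (nhds t)" unfolding eventually_nhds using b(1) by (intro exI[of _ "{..<b}"]) auto
    ultimately show ?thesis by (auto elim: eventually_mono)
  qed
qed

lemma mono_measure_atMost:
  assumes "regular_finite_borel (M :: 'a::linorder_topology measure)"
  shows "mono (\<lambda>t. measure M {..t})"
proof (rule monoI)
  interpret finite_measure M using assms by (simp add: regular_finite_borel_def)
  show "x \<le> y \<Longrightarrow> measure M {..x} \<le> measure M {..y}" for x y
    using assms by (intro finite_measure_mono) (auto simp: regular_finite_borel_def)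
qed

lemma summable_on_mult_of_bool:
  fixes w :: "'t \<Rightarrow> real"
  assumes "w summable_on Q"
  shows "(\<lambda>t. w t * of_bool (P t)) summable_on Q"
proof -
  have "w summable_on (Q \<inter> Collect P)" using summable_on_subset_banach[OF assms, of "Q \<inter> Collect P"] by auto
  then show ?thesis by (rule summable_on_cong_neutral[THEN iffD1, rotated -1]) auto
qed

text \<open>The distribution function of the point masses \<open>w t\<close> at
  \<open>p t\<close>.\<close>

definition step_sum :: "'t set \<Rightarrow> ('t \<Rightarrow> real) \<Rightarrow> ('t \<Rightarrow> 'a::linorder) \<Rightarrow> 'a \<Rightarrow> real" where
  "step_sum Q w p x = (\<Sum>\<^sub>\<infinity>t\<in>Q. w t * of_bool (p t \<le> x))"

text \<open>For upper semicontinuity, a finite \<open>T\<close> carries all but \<open>e / 2\<close>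
  of the weight, and near \<open>x\<close> no further jump with index in \<open>T\<close> is passed;
  the remaining indices contribute at most \<open>e / 2\<close>.\<close>

lemma step_sum:
  fixes w :: "'t \<Rightarrow> real" and p :: "'t \<Rightarrow> 'a::linorder_topology"
  assumes w: "w summable_on Q" "\<And>t. t \<in> Q \<Longrightarrow> 0 \<le> w t"
  shows "mono (step_sum Q w p)" "0 \<le> step_sum Q w p x" "step_sum Q w p x \<le> infsum w Q"
    "usc (step_sum Q w p)"
proof -
  let ?D = "step_sum Q w p"
  note sm = summable_on_mult_of_bool[OF w(1)]
  show "mono ?D" unfolding step_sum_def
    by (intro monoI infsum_mono sm) (use w(2) in \<open>auto simp: of_bool_def\<close>)
  show "0 \<le> ?D x" unfolding step_sum_def by (intro infsum_nonneg) (use w(2) in auto)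
  show "?D x \<le> infsum w Q" unfolding step_sum_def by (intro infsum_mono sm w) (use w(2) in auto)
  show "usc ?D" unfolding usc_def
  proof (intro allI impI)
    fix x and e :: real assume "e > 0"
    then have "e / 2 > 0" by simp
    then obtain T where T: "finite T" "T \<subseteq> Q" "dist (sum w T) (infsum w Q) \<le> e / 2"
      using infsum_finite_approximation[OF w(1)] by blast
    have wT: "infsum (\<lambda>t. w t * of_bool (t \<notin> T)) Q \<le> e / 2"
    proof -
      have "infsum w Q = infsum (\<lambda>t. w t * of_bool (t \<in> T) + w t * of_bool (t \<notin> T)) Q"
        by (rule infsum_cong) auto
      also have "\<dots> = infsum (\<lambda>t. w t * of_bool (t \<in> T)) Q + infsum (\<lambda>t. w t * of_bool (t \<notin> T)) Q"
        by (intro infsum_add sm)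
      also have "infsum (\<lambda>t. w t * of_bool (t \<in> T)) Q = infsum w T"
        using T by (intro infsum_cong_neutral) auto
      finally show ?thesis using T by (simp add: dist_real_def)
    qed
    have "eventually (\<lambda>s. \<forall>t\<in>T. p t \<le> s \<longrightarrow> p t \<le> x) (nhds x)"
    proof (rule eventually_ball_finite[OF T(1)], rule ballI)
      fix t assume "t \<in> T"
      show "eventually (\<lambda>s. p t \<le> s \<longrightarrow> p t \<le> x) (nhds x)"
      proof (cases "p t \<le> x")
        case False
        then have "eventually (\<lambda>s. s < p t) (nhds x)"
          unfolding eventually_nhds by (intro exI[of _ "{..<p t}"]) auto
        then show ?thesis by eventually_elim auto
      qed auto
    qed
    then show "eventually (\<lambda>s. ?D s < ?D x + e) (nhds x)"
    proof eventually_elim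
      case (elim s)
      have "?D s \<le> infsum (\<lambda>t. w t * of_bool (p t \<le> x) + w t * of_bool (t \<notin> T)) Q"
        unfolding step_sum_def using elim w(2) by (intro infsum_mono sm summable_on_add) (auto simp: of_bool_def)
      also have "\<dots> = ?D x + infsum (\<lambda>t. w t * of_bool (t \<notin> T)) Q"
        unfolding step_sum_def by (intro infsum_add sm)
      finally show ?case using wT \<open>e > 0\<close> by simp
    qed
  qed
qed

section \<open>Existence of the extension\<close>

lemma compact_line_continuous_bounded:
  fixes f :: "'a::topological_space \<Rightarrow> real"
  assumes "compact (UNIV :: 'a set)" "continuous_on UNIV f"
  shows "\<exists>C. \<forall>x. \<bar>f x\<bar> \<le> C"
  using compact_imp_bounded[OF compact_continuous_image[OF assms(2,1)]] by (simp add: bounded_iff)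

lemma integrable_continuous_compact:
  fixes f :: "'a::topological_space \<Rightarrow> real"
  assumes K: "compact (UNIV :: 'a set)" and f: "continuous_on UNIV f"
    and M: "finite_measure M" "sets M = sets borel"
  shows "integrable M f"
proof -
  obtain C where "\<And>x. \<bar>f x\<bar> \<le> C" using compact_line_continuous_bounded[OF K f] by blast
  then show ?thesis by (intro integrable_bounded_borel[OF M borel_measurable_continuous_onI[OF f]])
qed

text \<open>\<open>cl t\<close> is the retraction of the line onto the fibre [u, v]. Hence
  \<open>f\<close> composed with it agrees with \<open>f\<close> on this fibre and is constant on
  every other one.\<close>

lemma clamp_fibre:
  fixes \<phi> :: "'k::linorder_topology \<Rightarrow> 'l::linorder_topology"
  assumes K: "compact (UNIV :: 'k set)" and \<phi>: "continuous_on UNIV \<phi>" "mono \<phi>" "surj \<phi>"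
  defines "cl \<equiv> \<lambda>t x. max (fibre_min \<phi> t) (min x (fibre_max \<phi> t))"
  shows "x \<le> fibre_min \<phi> t \<Longrightarrow> cl t x = fibre_min \<phi> t" "fibre_max \<phi> t \<le> x \<Longrightarrow> cl t x = fibre_max \<phi> t"
    "\<phi> x = t \<Longrightarrow> cl t x = x" "\<phi> x = \<phi> y \<Longrightarrow> \<phi> x \<noteq> t \<Longrightarrow> cl t x = cl t y"
    "continuous_on UNIV f \<Longrightarrow> continuous_on UNIV (\<lambda>x. f (cl t x) :: real)"
proof -
  note fib = fibre_bounds[OF K \<phi>]
  have le: "fibre_min \<phi> t \<le> fibre_max \<phi> t" by (rule fib)
  show 1: "x \<le> fibre_min \<phi> t \<Longrightarrow> cl t x = fibre_min \<phi> t" for x using le by (auto simp: cl_def max_def min_def)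
  show 2: "fibre_max \<phi> t \<le> x \<Longrightarrow> cl t x = fibre_max \<phi> t" for x using le by (auto simp: cl_def max_def min_def)
  show "\<phi> x = t \<Longrightarrow> cl t x = x" unfolding fib(3) by (simp add: cl_def)
  show "cl t x = cl t y" if "\<phi> x = \<phi> y" "\<phi> x \<noteq> t"
  proof (cases "\<phi> x \<le> t")
    case True
    then have "\<not> t \<le> \<phi> x" "\<not> t \<le> \<phi> y" using that by auto
    then show ?thesis unfolding fib(5) using 1 by simp
  next
    case False
    then have "\<not> \<phi> x \<le> t" "\<not> \<phi> y \<le> t" using that by auto
    then show ?thesis unfolding fib(4) using 2 by simp
  qed
  have "continuous_on UNIV (cl t)" unfolding cl_def by (intro continuous_intros)
  then show "continuous_on UNIV f \<Longrightarrow> continuous_on UNIV (\<lambda>x. f (cl t x) :: real)"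
    by (rule continuous_on_compose2[rotated]) auto
qed

text \<open>A continuous map from a compact space to a Hausdorff space is closed, so the surjection
  \<open>\<phi>\<close> is a quotient map.\<close>

lemma continuous_on_factor:
  fixes \<phi> :: "'k::topological_space \<Rightarrow> 'l::t2_space" and f :: "'k \<Rightarrow> real"
  assumes K: "compact (UNIV :: 'k set)" and \<phi>: "continuous_on UNIV \<phi>" "surj \<phi>"
    and f: "continuous_on UNIV f" and g: "\<And>x. g (\<phi> x) = f x"
  shows "continuous_on UNIV g"
  unfolding continuous_on_closed_vimage[OF closed_UNIV]
proof (intro allI impI)
  fix B :: "real set" assume "closed B"
  then have "closed (f -` B)"
    using f by (simp add: continuous_on_closed_vimage[OF closed_UNIV])
  then have "compact (f -` B)" using compact_Int_closed[OF K] by fastforce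
  then have "compact (\<phi> ` (f -` B))"
    using continuous_on_subset[OF \<phi>(1)] by (intro compact_continuous_image) auto
  moreover have "g -` B \<inter> UNIV = \<phi> ` (f -` B)"
  proof (intro equalityI subsetI)
    fix t assume "t \<in> g -` B \<inter> UNIV"
    moreover obtain x where "t = \<phi> x" using \<phi>(2) by (rule surjE)
    ultimately show "t \<in> \<phi> ` (f -` B)" using g by auto
  qed (use g in auto)
  ultimately show "closed (g -` B \<inter> UNIV)" by (simp add: compact_imp_closed)
qed

text \<open>The obstruction to descending along \<open>\<phi>\<close>: the set is empty exactly if
  \<open>f x\<close> is a function of \<open>\<phi> x\<close>.\<close>

definition multivalued_fibres :: "('k \<Rightarrow> 'l) \<Rightarrow> ('k \<Rightarrow> real) \<Rightarrow> 'l set" where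
  "multivalued_fibres \<phi> f = {t. \<exists>x y. \<phi> x = t \<and> \<phi> y = t \<and> f x \<noteq> f y}"

lemma multivalued_fibresI: "\<phi> x = \<phi> y \<Longrightarrow> f x \<noteq> f y \<Longrightarrow> \<phi> y \<in> multivalued_fibres \<phi> f"
  by (auto simp: multivalued_fibres_def)

lemma multivalued_fibres_subset_Qset: "multivalued_fibres \<phi> f \<subseteq> Qset \<phi>"
  by (force simp: multivalued_fibres_def Qset_def)

text \<open>Two points of one fibre are separated by a cutoff composed with the retraction onto that
  fibre, two points of different fibres by a cutoff pulled back from the target line.\<close>

lemma function_ring_multivalued_fibres:
  fixes \<phi> :: "'k::linorder_topology \<Rightarrow> 'l::linorder_topology"
  assumes K: "compact (UNIV :: 'k set)" and L: "compact (UNIV :: 'l set)"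
    and \<phi>: "continuous_on UNIV \<phi>" "mono \<phi>" "surj \<phi>"
  shows "function_ring_on {f. continuous_on UNIV f \<and> finite (multivalued_fibres \<phi> f)} UNIV"
proof
  show "compact (UNIV :: 'k set)" by (rule K)
  show "continuous_on UNIV f" if "f \<in> {f. continuous_on UNIV f \<and> finite (multivalued_fibres \<phi> f)}" for f
    using that by simp
  fix f g assume "f \<in> {f. continuous_on UNIV f \<and> finite (multivalued_fibres \<phi> f)}"
    "g \<in> {f. continuous_on UNIV f \<and> finite (multivalued_fibres \<phi> f)}"
  then have c: "continuous_on UNIV f" "continuous_on UNIV g"
    and fin: "finite (multivalued_fibres \<phi> f \<union> multivalued_fibres \<phi> g)" by auto
  have "multivalued_fibres \<phi> (\<lambda>x. f x + g x) \<subseteq> multivalued_fibres \<phi> f \<union> multivalued_fibres \<phi> g"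
  proof
    fix t assume "t \<in> multivalued_fibres \<phi> (\<lambda>x. f x + g x)"
    then obtain x y where t: "\<phi> x = t" "\<phi> y = t" "f x + g x \<noteq> f y + g y"
      by (auto simp: multivalued_fibres_def)
    then have "f x \<noteq> f y \<or> g x \<noteq> g y" by auto
    then show "t \<in> multivalued_fibres \<phi> f \<union> multivalued_fibres \<phi> g"
      using t(1,2) unfolding multivalued_fibres_def by blast
  qed
  then show "(\<lambda>x. f x + g x) \<in> {f. continuous_on UNIV f \<and> finite (multivalued_fibres \<phi> f)}"
    using c fin by (auto intro!: continuous_intros intro: finite_subset)
  have "multivalued_fibres \<phi> (\<lambda>x. f x * g x) \<subseteq> multivalued_fibres \<phi> f \<union> multivalued_fibres \<phi> g"
  proof
    fix t assume "t \<in> multivalued_fibres \<phi> (\<lambda>x. f x * g x)"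
    then obtain x y where t: "\<phi> x = t" "\<phi> y = t" "f x * g x \<noteq> f y * g y"
      by (auto simp: multivalued_fibres_def)
    then have "f x \<noteq> f y \<or> g x \<noteq> g y" by auto
    then show "t \<in> multivalued_fibres \<phi> f \<union> multivalued_fibres \<phi> g"
      using t(1,2) unfolding multivalued_fibres_def by blast
  qed
  then show "(\<lambda>x. f x * g x) \<in> {f. continuous_on UNIV f \<and> finite (multivalued_fibres \<phi> f)}"
    using c fin by (auto intro!: continuous_intros intro: finite_subset)
next
  show "(\<lambda>_. c) \<in> {f. continuous_on UNIV f \<and> finite (multivalued_fibres \<phi> f)}" for c
    by (auto simp: multivalued_fibres_def)
next
  have sep: "\<exists>f\<in>{f. continuous_on UNIV f \<and> finite (multivalued_fibres \<phi> f)}. f x \<noteq> f y" if xy: "x < y" for x y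
  proof (cases "\<phi> x = \<phi> y")
    case True
    obtain q where q: "continuous_on UNIV q \<and> (\<forall>s. 0 \<le> q s \<and> q s \<le> (1::real)) \<and> (\<forall>s\<le>x. q s = 1) \<and> (\<forall>s\<ge>y. q s = 0)"
      using continuous_cutoff_between[OF K xy] ..
    define t where "t = \<phi> x"
    define h where "h z = q (max (fibre_min \<phi> t) (min z (fibre_max \<phi> t)))" for z
    have "multivalued_fibres \<phi> h \<subseteq> {t}"
    proof
      fix s assume "s \<in> multivalued_fibres \<phi> h"
      then obtain y z where s: "\<phi> y = s" "\<phi> z = s" "h y \<noteq> h z" by (auto simp: multivalued_fibres_def)
      then show "s \<in> {t}" using clamp_fibre(4)[OF K \<phi>, of y z t] unfolding h_def by force
    qed
    moreover have "continuous_on UNIV h" unfolding h_def using clamp_fibre(5)[OF K \<phi>] q by blast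
    moreover have "h x = 1" "h y = 0"
      unfolding h_def using clamp_fibre(3)[OF K \<phi>, of x t] clamp_fibre(3)[OF K \<phi>, of y t] q True by (auto simp: t_def)
    ultimately show ?thesis by (intro bexI[of _ h]) (auto intro: finite_subset)
  next
    case False
    then have lt: "\<phi> x < \<phi> y" using monoD[OF \<phi>(2) less_imp_le[OF xy]] by simp
    obtain q where q: "continuous_on UNIV q \<and> (\<forall>s. 0 \<le> q s \<and> q s \<le> (1::real)) \<and> (\<forall>s\<le>\<phi> x. q s = 1) \<and> (\<forall>s\<ge>\<phi> y. q s = 0)"
      using continuous_cutoff_between[OF L lt] ..
    have "continuous_on UNIV (\<lambda>x. q (\<phi> x))" using q \<phi>(1) by (auto intro: continuous_on_compose2)
    moreover have "multivalued_fibres \<phi> (\<lambda>x. q (\<phi> x)) = {}" by (auto simp: multivalued_fibres_def)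
    ultimately show ?thesis using q by (intro bexI[of _ "\<lambda>x. q (\<phi> x)"]) auto
  qed
  show "\<exists>f\<in>{f. continuous_on UNIV f \<and> finite (multivalued_fibres \<phi> f)}. f x \<noteq> f y" if "x \<noteq> y" for x y
    using sep[of x y] sep[of y x] that by (metis linorder_neq_iff)
qed

text \<open>Nonconstancy is removed one fibre at a time by subtracting \<open>f\<close> composed
  with the retraction onto it; what finally remains factors through \<open>\<phi>\<close>. The
  uniform bound \<open>B\<close> permits the passage from the dense algebra to all continuous
  functions.\<close>

lemma weak_star_null_lift:
  fixes \<phi> :: "'k::linorder_topology \<Rightarrow> 'l::linorder_topology" and F :: "'i \<Rightarrow> 'l \<Rightarrow> real"
  assumes K: "compact (UNIV :: 'k set)" and L: "compact (UNIV :: 'l set)"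
    and \<phi>: "continuous_on UNIV \<phi>" "mono \<phi>" "surj \<phi>"
    and M: "\<And>i. associated_measure (F i) (M1 i) (M2 i)"
    and null: "\<And>f :: 'l \<Rightarrow> real. continuous_on UNIV f \<Longrightarrow> fam_lim0 (\<lambda>i. integral\<^sup>L (M1 i) f - integral\<^sup>L (M2 i) f)"
    and N: "\<And>i. associated_measure (G i) (N1 i) (N2 i)"
    and bv: "\<And>i. bounded_variation (G i)" "\<And>i. bv_norm (G i) \<le> B"
    and GF: "\<And>i t. G i (fibre_max \<phi> t) = F i t"
    and Ga: "\<And>i t x. t \<in> Qset \<phi> \<Longrightarrow> fibre_min \<phi> t \<le> x \<Longrightarrow> x < fibre_max \<phi> t \<Longrightarrow> G i x = a i t"
    and a: "\<And>t. t \<in> Qset \<phi> \<Longrightarrow> fam_lim0 (\<lambda>i. a i t)"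
    and f: "continuous_on UNIV f"
  shows "fam_lim0 (\<lambda>i. integral\<^sup>L (N1 i) f - integral\<^sup>L (N2 i) f)"
proof -
  note fib = fibre_bounds[OF K \<phi>]
  note DM = associated_measureD[OF L M] and DN = associated_measureD[OF K N]
  note cont_meas = borel_measurable_continuous_onI
  define J where "J i f = integral\<^sup>L (N1 i) f - integral\<^sup>L (N2 i) f" for i and f :: "'k \<Rightarrow> real"
  have spN: "space (N1 i) = UNIV" "space (N2 i) = UNIV" for i
    using DN(3,4)[of i] sets_eq_imp_space_eq[of _ borel] by auto
  have int: "integrable (N1 i) f" "integrable (N2 i) f" if "continuous_on UNIV f" for i and f :: "'k \<Rightarrow> real"
    using integrable_continuous_compact[OF K that] DN by auto
  have Jlin: "J i (\<lambda>x. c * f x + d * g x) = c * J i f + d * J i g" if "continuous_on UNIV f" "continuous_on UNIV g" for i f g c d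
    unfolding J_def using int that by (simp add: algebra_simps)
  have comp: "fam_lim0 (\<lambda>i. J i (\<lambda>x. g (\<phi> x)))" if g: "continuous_on UNIV g" for g
  proof -
    have "J i (\<lambda>x. g (\<phi> x)) = integral\<^sup>L (M1 i) g - integral\<^sup>L (M2 i) g" for i
    proof -
      have gm: "g \<in> borel_measurable borel" by (rule cont_meas[OF g])
      have pm: "\<phi> \<in> measurable (N1 i) borel" "\<phi> \<in> measurable (N2 i) borel"
        using cont_meas[OF \<phi>(1)] DN(3,4)[of i] by (auto cong: measurable_cong_sets)
      obtain C where C: "\<And>x. \<bar>g x\<bar> \<le> C" using compact_line_continuous_bounded[OF L g] by blast
      have vim: "\<phi> -` {..t} = {..fibre_max \<phi> t}" for t using fib(4) by auto
      \<comment> \<open>The image measures may differ from \<open>M1 i\<close> and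
        \<open>M2 i\<close>, but both pairs have the distribution function \<open>F i\<close>, so
        they integrate \<open>g\<close> alike.\<close>
      have "integral\<^sup>L (distr (N1 i) borel \<phi>) g - integral\<^sup>L (distr (N2 i) borel \<phi>) g = integral\<^sup>L (M1 i) g - integral\<^sup>L (M2 i) g"
      proof (rule signed_integral_eqI[OF L gm C step_approximable_continuous[OF L g] gm C step_approximable_continuous[OF L g]])
        show "finite_measure (distr (N1 i) borel \<phi>)" "finite_measure (distr (N2 i) borel \<phi>)"
          using finite_measure.finite_measure_distr[OF DN(1) pm(1)] finite_measure.finite_measure_distr[OF DN(2) pm(2)] .
        show "measure (distr (N1 i) borel \<phi>) {..t} - measure (distr (N2 i) borel \<phi>) {..t} = F i t" for t
          using GF[of i t] unfolding DN(5) by (simp add: measure_distr pm spN vim)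
        show "measure (M1 i) {..t} - measure (M2 i) {..t} = F i t" for t unfolding DM(5) ..
      qed (use DM in auto)
      then show ?thesis unfolding J_def using integral_distr[OF pm(1) gm] integral_distr[OF pm(2) gm] by simp
    qed
    then show ?thesis using null[OF g] by simp
  qed
  have one: "fam_lim0 (\<lambda>i. J i (\<lambda>x. 1))" using comp[of "\<lambda>_. 1"] by simp
  have clamp: "fam_lim0 (\<lambda>i. J i (\<lambda>x. f (max (fibre_min \<phi> t) (min x (fibre_max \<phi> t)))))"
    if t: "t \<in> Qset \<phi>" and f: "continuous_on UNIV f" for f t
  proof -
    let ?u = "fibre_min \<phi> t" and ?v = "fibre_max \<phi> t"
    have uv: "?u < ?v" using t fib(7) by simp
    define fc where "fc x = f (max ?u (min x ?v))" for x
    define h where "h x = fc x - f ?v" for x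
    \<comment> \<open>\<open>h\<close> is constant up to u and 0 from v on. In between,
      \<open>G i\<close> is constant on [u, v), so changing \<open>h\<close> there leaves the
      integral unchanged. The integral of \<open>h'\<close> is f(u) - f(v) times the value of
      \<open>G i\<close> at u, which is \<open>a i t\<close>.\<close>
    define h' where "h' x = (f ?u - f ?v) * indicator {..?u} x" for x
    have fc: "continuous_on UNIV fc" unfolding fc_def by (rule clamp_fibre(5)[OF K \<phi> f])
    then have hc: "continuous_on UNIV h" unfolding h_def by (intro continuous_intros)
    obtain C where C: "\<And>x. \<bar>h x\<bar> \<le> C" using compact_line_continuous_bounded[OF K hc] by blast
    have hu: "h x = f ?u - f ?v" if "x \<le> ?u" for x unfolding h_def fc_def using clamp_fibre(1)[OF K \<phi> that] by simp
    have hv: "h x = 0" if "?v \<le> x" for x unfolding h_def fc_def using clamp_fibre(2)[OF K \<phi> that] by simp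
    have eq: "J i h = integral\<^sup>L (N1 i) h' - integral\<^sup>L (N2 i) h'" for i
      unfolding J_def
    proof (rule signed_integral_eqI[OF K cont_meas[OF hc] C step_approximable_continuous[OF K hc], of h' "\<bar>f ?u - f ?v\<bar>" _ _ _ _ "G i" "{?u, ?v}"])
      show "h' \<in> borel_measurable borel" unfolding h'_def by simp
      show "\<bar>h' x\<bar> \<le> \<bar>f ?u - f ?v\<bar>" for x unfolding h'_def by (simp add: indicator_def)
      show "step_approximable h'" unfolding h'_def by (intro step_approximable_cmult step_approximable_atMost)
      show "measure (N1 i) {..t} - measure (N2 i) {..t} = G i t" for t unfolding DN(5) ..
      then show "measure (N1 i) {..t} - measure (N2 i) {..t} = G i t" for t .
      have "h line_min = h' line_min" using hu[of line_min] line_min_le[OF K, of ?u] by (simp add: h'_def)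
      then show "h line_min * G i line_min = h' line_min * G i line_min" by simp
      fix x y assume xy: "x < y" "{x<..<y} \<inter> {?u, ?v} = {}"
      consider "y \<le> ?u" | "?v \<le> y" | "?u < y" "y < ?v" by force
      then show "h y * (G i y - G i x) = h' y * (G i y - G i x)"
      proof cases
        case 1
        then show ?thesis using hu by (simp add: h'_def)
      next
        case 2
        then show ?thesis using hv uv by (simp add: h'_def)
      next
        case 3
        then have "?u \<le> x" using xy by (auto simp: not_less)
        then have "G i x = a i t" "G i y = a i t" using Ga[OF t] 3 xy by auto
        then show ?thesis by simp
      qed
    qed (use DN in auto)
    have "J i h = (f ?u - f ?v) * a i t" for i
    proof -
      have "integral\<^sup>L (N1 i) h' - integral\<^sup>L (N2 i) h' = (f ?u - f ?v) * (measure (N1 i) {..?u} - measure (N2 i) {..?u})"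
        unfolding h'_def integral_mult_right_zero by (simp add: spN right_diff_distrib)
      also have "measure (N1 i) {..?u} - measure (N2 i) {..?u} = G i ?u" unfolding DN(5) ..
      also have "\<dots> = a i t" using Ga[OF t] uv by simp
      finally show ?thesis using eq by simp
    qed
    moreover have "J i h = J i fc - f ?v * J i (\<lambda>_. 1)" for i
      using Jlin[OF fc continuous_on_const, of i 1 "- f ?v" 1] by (simp add: h_def[abs_def])
    \<comment> \<open>The constant that separates \<open>h\<close> from \<open>fc\<close>
      contributes f(v) times the integral of 1, which tends to 0 because constants are pulled back
      from the target line.\<close>
    ultimately have "(\<lambda>i. J i fc) = (\<lambda>i. (f ?u - f ?v) * a i t + f ?v * J i (\<lambda>_. 1))" by (simp add: fun_eq_iff algebra_simps)
    then show ?thesis using fam_lim0_lincomb[OF a[OF t] one] unfolding fc_def by simp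
  qed
  \<comment> \<open>The induction runs over a finite superset \<open>X\<close> of the exceptional
    fibres, so that a point of \<open>X\<close> outside \<open>Qset \<phi>\<close> can simply be
    dropped.\<close>
  have dense: "fam_lim0 (\<lambda>i. J i f)" if "finite X" "continuous_on UNIV f" "multivalued_fibres \<phi> f \<subseteq> X" for X f
    using that
  proof (induction X arbitrary: f rule: finite_induct)
    case empty
    define g where "g t = f (fibre_max \<phi> t)" for t
    have g: "g (\<phi> x) = f x" for x
    proof -
      have "\<phi> x \<notin> multivalued_fibres \<phi> f" using empty by auto
      then show ?thesis
        using multivalued_fibresI[of \<phi> "fibre_max \<phi> (\<phi> x)" x f] fib(2)[of "\<phi> x"] unfolding g_def by metis
    qed
    have "continuous_on UNIV g" by (rule continuous_on_factor[OF K \<phi>(1,3) empty(1) g])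
    from comp[OF this] show ?case by (simp add: g)
  next
    case (insert t X)
    show ?case
    proof (cases "t \<in> Qset \<phi>")
      case False
      then have "t \<notin> multivalued_fibres \<phi> f" using multivalued_fibres_subset_Qset[of \<phi> f] by auto
      then show ?thesis using insert by (intro insert.IH) auto
    next
      case True
      define fc where "fc x = f (max (fibre_min \<phi> t) (min x (fibre_max \<phi> t)))" for x
      have fc: "continuous_on UNIV fc" unfolding fc_def by (rule clamp_fibre(5)[OF K \<phi> insert.prems(1)])
      have "fam_lim0 (\<lambda>i. J i (\<lambda>x. 1 * f x + (- 1) * fc x))"
      proof (rule insert.IH)
        show "continuous_on UNIV (\<lambda>x. 1 * f x + (- 1) * fc x)" by (intro continuous_intros fc insert.prems)
        show "multivalued_fibres \<phi> (\<lambda>x. 1 * f x + (- 1) * fc x) \<subseteq> X"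
        proof
          fix s assume "s \<in> multivalued_fibres \<phi> (\<lambda>x. 1 * f x + (- 1) * fc x)"
          then obtain x y where s: "\<phi> x = s" "\<phi> y = s" "f x - fc x \<noteq> f y - fc y" by (auto simp: multivalued_fibres_def)
          have "s \<noteq> t" using s clamp_fibre(3)[OF K \<phi>, of x t] clamp_fibre(3)[OF K \<phi>, of y t] unfolding fc_def by auto
          then have "fc x = fc y" unfolding fc_def using clamp_fibre(4)[OF K \<phi>, of x y t] s by simp
          then have "s \<in> multivalued_fibres \<phi> f" using s by (auto simp: multivalued_fibres_def)
          then show "s \<in> X" using insert.prems(2) \<open>s \<noteq> t\<close> by auto
        qed
      qed
      moreover have "fam_lim0 (\<lambda>i. J i fc)" unfolding fc_def by (rule clamp[OF True insert.prems(1)])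
      ultimately have "fam_lim0 (\<lambda>i. 1 * J i (\<lambda>x. 1 * f x + (- 1) * fc x) + 1 * J i fc)" by (rule fam_lim0_lincomb)
      then show ?thesis unfolding Jlin[OF insert.prems(1) fc] by simp
    qed
  qed
  have "finite {i. e \<le> \<bar>J i f\<bar>}" if e: "0 < e" for e
  proof -
    define B' where "B' = \<bar>B\<bar> + 1"
    \<comment> \<open>An error of \<open>d\<close> in the function costs at most
      \<open>d * B'\<close>, that is \<open>e / 2\<close>, in every integral.\<close>
    define d where "d = e / (2 * B')"
    have "0 < B'" by (simp add: B'_def)
    then have d: "0 < d" "d * B' = e / 2" using e by (auto simp: d_def)
    interpret function_ring_on "{f. continuous_on UNIV f \<and> finite (multivalued_fibres \<phi> f)}" UNIV
      by (rule function_ring_multivalued_fibres[OF K L \<phi>])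
    obtain g where g: "continuous_on UNIV g" "finite (multivalued_fibres \<phi> g)" "\<And>x. \<bar>f x - g x\<bar> < d"
      using Stone_Weierstrass_basic[OF f d(1)] by auto
    have "{i. e \<le> \<bar>J i f\<bar>} \<subseteq> {i. e / 2 \<le> \<bar>J i g\<bar>}"
    proof (rule Collect_mono, rule impI)
      fix i assume i: "e \<le> \<bar>J i f\<bar>"
      have c: "continuous_on UNIV (\<lambda>x. 1 * f x + (- 1) * g x)" by (intro continuous_intros f g)
      have "\<bar>1 * f x + (- 1) * g x\<bar> \<le> d" for x using g(3)[of x] by simp
      then have "\<bar>J i (\<lambda>x. 1 * f x + (- 1) * g x)\<bar> \<le> d * bv_norm (G i)"
        unfolding J_def by (rule abs_integral_le_bv_norm[OF K cont_meas[OF c] _ step_approximable_continuous[OF K c] N bv(1)])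
      also have "\<dots> \<le> d * B'" using d bv(2)[of i] by (intro mult_left_mono) (auto simp: B'_def)
      finally have "\<bar>J i f - J i g\<bar> \<le> e / 2" unfolding Jlin[OF f g(1)] d(2) by simp
      then show "e / 2 \<le> \<bar>J i g\<bar>" using i by linarith
    qed
    moreover have "finite {i. e / 2 \<le> \<bar>J i g\<bar>}"
      using dense[OF g(2,1) order_refl] e unfolding fam_lim0_def by (auto dest: spec[of _ "e / 2"])
    ultimately show ?thesis by (rule finite_subset)
  qed
  then show ?thesis unfolding fam_lim0_def J_def by blast
qed

section \<open>Variation and measures of the extension\<close>

lemma bv_norm_upper_weak:
  assumes "bounded_variation F" "sorted xs"
  shows "\<bar>F line_min\<bar> + (\<Sum>j < length xs - 1. \<bar>F (xs ! Suc j) - F (xs ! j)\<bar>) \<le> bv_norm F"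
proof -
  have "\<exists>zs. sorted_wrt (<) zs \<and> (xs \<noteq> [] \<longrightarrow> zs \<noteq> [] \<and> hd zs = hd xs) \<and>
     (\<Sum>j < length zs - 1. \<bar>F (zs ! Suc j) - F (zs ! j)\<bar>) = (\<Sum>j < length xs - 1. \<bar>F (xs ! Suc j) - F (xs ! j)\<bar>)"
    using assms(2)
  proof (induction xs)
    case Nil
    show ?case by (intro exI[of _ "[]"]) simp
  next
    case (Cons x xs)
    show ?case
    proof (cases xs)
      case Nil
      then show ?thesis by (intro exI[of _ "[x]"]) simp
    next
      case xs: (Cons y ys)
      obtain zs where zs: "sorted_wrt (<) zs" "zs \<noteq> []" "hd zs = y"
        "(\<Sum>j < length zs - 1. \<bar>F (zs ! Suc j) - F (zs ! j)\<bar>) = (\<Sum>j < length xs - 1. \<bar>F (xs ! Suc j) - F (xs ! j)\<bar>)"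
        using Cons xs by auto
      obtain ws where ws: "zs = y # ws" using zs by (cases zs) auto
      have sum: "(\<Sum>j < length (x # xs) - 1. \<bar>F ((x # xs) ! Suc j) - F ((x # xs) ! j)\<bar>)
         = \<bar>F y - F x\<bar> + (\<Sum>j < length xs - 1. \<bar>F (xs ! Suc j) - F (xs ! j)\<bar>)"
        by (simp add: xs sum.lessThan_Suc_shift del: sum.lessThan_Suc)
      show ?thesis
      proof (cases "x = y")
        case True
        then show ?thesis using zs sum by (intro exI[of _ zs]) simp
      next
        case False
        then have "x < y" using Cons.prems xs by (simp add: order.strict_iff_order)
        then have "sorted_wrt (<) (x # zs)" using zs(1) ws by auto
        moreover have "(\<Sum>j < length (x # zs) - 1. \<bar>F ((x # zs) ! Suc j) - F ((x # zs) ! j)\<bar>)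
           = \<bar>F y - F x\<bar> + (\<Sum>j < length zs - 1. \<bar>F (zs ! Suc j) - F (zs ! j)\<bar>)"
          by (simp add: ws sum.lessThan_Suc_shift del: sum.lessThan_Suc)
        ultimately show ?thesis using zs(4) sum by (intro exI[of _ "x # zs"]) simp
      qed
    qed
  qed
  then show ?thesis using bv_norm_upper[OF assms(1)] by metis
qed

text \<open>The increments of a monotone function telescope, and together with its value at
  \<open>line_min\<close> they stay below its upper bound. So \<open>D1\<close> and
  \<open>D2\<close> add at most \<open>C1\<close> and \<open>C2\<close>, their contributions at the
  least point included.\<close>

lemma bv_norm_comp_plus_mono:
  fixes \<phi> :: "'k::linorder \<Rightarrow> 'l::linorder"
  assumes F: "bounded_variation F" and \<phi>: "mono \<phi>" "\<phi> line_min = line_min"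
    and min: "\<And>x::'k. line_min \<le> x"
    and D: "mono D1" "mono D2" "\<And>x. 0 \<le> D1 x" "\<And>x. 0 \<le> D2 x" "\<And>x. D1 x \<le> C1" "\<And>x. D2 x \<le> C2"
  defines "G \<equiv> \<lambda>x. F (\<phi> x) + D1 x - D2 x"
  shows "bounded_variation G" "bv_norm G \<le> bv_norm F + C1 + C2"
proof -
  have "\<bar>G line_min\<bar> + (\<Sum>j < length xs - 1. \<bar>G (xs ! Suc j) - G (xs ! j)\<bar>) \<le> bv_norm F + C1 + C2"
    if xs: "sorted_wrt (<) xs" for xs
  proof -
    define n where "n = length xs - 1"
    have mono_sum: "D line_min + (\<Sum>j < n. \<bar>D (xs ! Suc j) - D (xs ! j)\<bar>) \<le> C"
      if D: "mono D" "\<And>x. D x \<le> C" for D :: "'k \<Rightarrow> real" and C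
    proof -
      have "\<bar>D (xs ! Suc j) - D (xs ! j)\<bar> = D (xs ! Suc j) - D (xs ! j)" if "j < n" for j
      proof -
        have "xs ! j < xs ! Suc j" using that by (intro sorted_wrt_nth_less[OF xs]) (auto simp: n_def)
        then show ?thesis using monoD[OF D(1) less_imp_le] by simp
      qed
      then have "(\<Sum>j < n. \<bar>D (xs ! Suc j) - D (xs ! j)\<bar>) = D (xs ! n) - D (xs ! 0)"
        using sum_lessThan_telescope[of "\<lambda>j. D (xs ! j)" n] by simp
      then show ?thesis using monoD[OF D(1) min[of "xs ! 0"]] D(2)[of "xs ! n"] by linarith
    qed
    have "sorted (map \<phi> xs)"
      using xs \<phi>(1) by (auto simp: sorted_wrt_map elim!: sorted_wrt_mono_rel[rotated] intro: monoD less_imp_le)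
    from bv_norm_upper_weak[OF F this]
    have F': "\<bar>F line_min\<bar> + (\<Sum>j < n. \<bar>F (\<phi> (xs ! Suc j)) - F (\<phi> (xs ! j))\<bar>) \<le> bv_norm F"
      unfolding n_def by simp
    have "\<bar>G (xs ! Suc j) - G (xs ! j)\<bar> \<le> \<bar>F (\<phi> (xs ! Suc j)) - F (\<phi> (xs ! j))\<bar>
        + \<bar>D1 (xs ! Suc j) - D1 (xs ! j)\<bar> + \<bar>D2 (xs ! Suc j) - D2 (xs ! j)\<bar>" for j
      unfolding G_def by linarith
    then have "(\<Sum>j < n. \<bar>G (xs ! Suc j) - G (xs ! j)\<bar>) \<le>
       (\<Sum>j < n. \<bar>F (\<phi> (xs ! Suc j)) - F (\<phi> (xs ! j))\<bar> + \<bar>D1 (xs ! Suc j) - D1 (xs ! j)\<bar> + \<bar>D2 (xs ! Suc j) - D2 (xs ! j)\<bar>)"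
      by (rule sum_mono)
    moreover have "\<bar>G line_min\<bar> \<le> \<bar>F line_min\<bar> + D1 line_min + D2 line_min"
      unfolding G_def \<phi>(2) using D(3,4)[of line_min] by linarith
    ultimately show ?thesis
      using F' mono_sum[OF D(1,5)] mono_sum[OF D(2,6)] unfolding n_def[symmetric] by (simp add: sum.distrib)
  qed
  note * = bounded_variationI[of G, OF this]
  show "bounded_variation G" by (rule *(1))
  show "bv_norm G \<le> bv_norm F + C1 + C2" by (rule *(2))
qed

lemma infsum_diff_real:
  fixes f g :: "'a \<Rightarrow> real"
  assumes "f summable_on A" "g summable_on A"
  shows "infsum (\<lambda>x. f x - g x) A = infsum f A - infsum g A"
  using infsum_add[OF assms(1), of "\<lambda>x. - g x"] assms(2)
  by (simp add: infsum_uminus summable_on_uminus)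

text \<open>The extension is built as an explicit difference of increasing functions, because this
  form yields both the measures of \<open>G i\<close> and the bound on its variation.\<close>

lemma exists_extension:
  fixes \<phi> :: "'k::linorder_topology \<Rightarrow> 'l::linorder_topology" and F :: "'i \<Rightarrow> 'l \<Rightarrow> real"
  assumes K: "compact (UNIV :: 'k set)" and L: "compact (UNIV :: 'l set)"
    and \<phi>: "continuous_on UNIV \<phi>" "mono \<phi>" "surj \<phi>"
    and F: "weak_star_null_NBV F"
    and k: "bdd_above (range k)" and ab: "c0l1_bounded_over (Qset \<phi>) F k"
  shows "\<exists>G :: 'i \<Rightarrow> 'k \<Rightarrow> real. weak_star_null_NBV G \<and> (\<forall>i. phi_star \<phi> (G i) = F i) \<and>
          (\<forall>i. bv_norm (G i) \<le> bv_norm (F i) + 2 * k i)"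
proof -
  note fib = fibre_bounds[OF K \<phi>]
  let ?u = "fibre_min \<phi>" and ?v = "fibre_max \<phi>" and ?Q = "Qset \<phi>"
  obtain a b where ab: "\<And>i t. t \<in> ?Q \<Longrightarrow> F i t = a i t + b i t" "\<And>t. t \<in> ?Q \<Longrightarrow> fam_lim0 (\<lambda>i. a i t)"
    "\<And>i. (\<lambda>t. \<bar>b i t\<bar>) summable_on ?Q" "\<And>i. (\<Sum>\<^sub>\<infinity>t\<in>?Q. \<bar>b i t\<bar>) \<le> k i"
    using ab unfolding c0l1_bounded_over_def by auto
  obtain M1 M2 where M: "\<And>i. associated_measure (F i) (M1 i) (M2 i)"
    and null: "\<And>f :: 'l \<Rightarrow> real. continuous_on UNIV f \<Longrightarrow> fam_lim0 (\<lambda>i. integral\<^sup>L (M1 i) f - integral\<^sup>L (M2 i) f)"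
    using F unfolding weak_star_null_NBV_def by blast
  have Fbv: "bounded_variation (F i)" for i using F by (auto simp: weak_star_null_NBV_def NBV_def)
  have reg: "regular_finite_borel (M1 i)" "regular_finite_borel (M2 i)" for i
    using M[of i] by (auto simp: associated_measure_def)
  note DM = associated_measureD[OF L M]
  define pp where "pp i t = max 0 (b i t)" for i t
  define nn where "nn i t = max 0 (- b i t)" for i t
  have nonneg: "0 \<le> pp i t" "0 \<le> nn i t" for i t by (auto simp: pp_def nn_def)
  have sm: "pp i summable_on ?Q" "nn i summable_on ?Q" for i
  proof -
    have "(\<lambda>t. norm (pp i t)) summable_on ?Q"
      by (rule Infinite_Sum.abs_summable_on_comparison_test[of "b i"]) (use ab(3) in \<open>auto simp: pp_def\<close>)
    moreover have "(\<lambda>t. norm (nn i t)) summable_on ?Q"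
      by (rule Infinite_Sum.abs_summable_on_comparison_test[of "b i"]) (use ab(3) in \<open>auto simp: nn_def\<close>)
    ultimately show "pp i summable_on ?Q" "nn i summable_on ?Q" by (simp_all add: nonneg)
  qed
  have sum_k: "infsum (pp i) ?Q + infsum (nn i) ?Q \<le> k i" for i
  proof -
    have "infsum (pp i) ?Q + infsum (nn i) ?Q = (\<Sum>\<^sub>\<infinity>t\<in>?Q. pp i t + nn i t)" by (rule infsum_add[OF sm, symmetric])
    also have "\<dots> = (\<Sum>\<^sub>\<infinity>t\<in>?Q. \<bar>b i t\<bar>)" by (rule infsum_cong) (auto simp: pp_def nn_def)
    finally show ?thesis using ab(4) by simp
  qed
  \<comment> \<open>The correction by -b_t on [u, v) jumps by -b_t at u and by b_t at v.
    \<open>D1\<close> collects the upward jumps and \<open>D2\<close> the downward ones; each has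
    total mass equal to the sum of the \<bar>b_t\<bar>, hence at most \<open>k i\<close>.\<close>
  define D1 where "D1 i x = step_sum ?Q (nn i) ?u x + step_sum ?Q (pp i) ?v x" for i x
  define D2 where "D2 i x = step_sum ?Q (pp i) ?u x + step_sum ?Q (nn i) ?v x" for i x
  have D: "mono (D1 i)" "mono (D2 i)" "usc (D1 i)" "usc (D2 i)" "0 \<le> D1 i x" "0 \<le> D2 i x"
    "D1 i x \<le> infsum (pp i) ?Q + infsum (nn i) ?Q" "D2 i x \<le> infsum (pp i) ?Q + infsum (nn i) ?Q" for i x
  proof -
    note p = step_sum[OF sm(1)[of i] nonneg(1)] and n = step_sum[OF sm(2)[of i] nonneg(2)]
    show "mono (D1 i)" "mono (D2 i)" unfolding D1_def D2_def
      using p(1)[THEN monoD] n(1)[THEN monoD] by (auto intro!: monoI add_mono)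
    show "usc (D1 i)" "usc (D2 i)" unfolding D1_def D2_def by (intro usc_add p(4) n(4))+
    show "0 \<le> D1 i x" "0 \<le> D2 i x" unfolding D1_def D2_def by (intro add_nonneg_nonneg p(2) n(2))+
    show "D1 i x \<le> infsum (pp i) ?Q + infsum (nn i) ?Q" "D2 i x \<le> infsum (pp i) ?Q + infsum (nn i) ?Q"
      unfolding D1_def D2_def using p(3)[of ?u x] p(3)[of ?v x] n(3)[of ?u x] n(3)[of ?v x] by simp_all
  qed
  \<comment> \<open>If t differs from \<open>\<phi> x\<close>, the point \<open>x\<close> lies on
    the same side of u and of v, so both jumps are passed or neither, and the term cancels.\<close>
  have D_diff: "D1 i x - D2 i x = (if \<phi> x \<in> ?Q \<and> x < ?v (\<phi> x) then - b i (\<phi> x) else 0)" for i x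
  proof -
    note sb = summable_on_mult_of_bool[OF sm(1)[of i]] summable_on_mult_of_bool[OF sm(2)[of i]]
    define c where "c t = nn i t * of_bool (?u t \<le> x) + pp i t * of_bool (?v t \<le> x) -
        (pp i t * of_bool (?u t \<le> x) + nn i t * of_bool (?v t \<le> x))" for t
    have "D1 i x - D2 i x = infsum c ?Q"
      unfolding D1_def D2_def step_sum_def c_def infsum_add[OF sb(2) sb(1), symmetric] infsum_add[OF sb(1) sb(2), symmetric]
      by (rule infsum_diff_real[symmetric]) (intro summable_on_add sb)+
    also have "\<dots> = infsum c (?Q \<inter> {\<phi> x})"
    proof (rule infsum_cong_neutral)
      fix t assume "t \<in> ?Q - ?Q \<inter> {\<phi> x}"
      then have "\<phi> x \<noteq> t" by auto
      then have "?u t \<le> x \<longleftrightarrow> ?v t \<le> x" using fib(3)[of x t] fib(6)[of t] by (metis linorder_linear order_trans)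
      then show "c t = 0" by (simp add: c_def of_bool_def)
    qed auto
    also have "\<dots> = (if \<phi> x \<in> ?Q \<and> x < ?v (\<phi> x) then - b i (\<phi> x) else 0)"
      using fib(3)[of x "\<phi> x"] by (auto simp: c_def pp_def nn_def)
    finally show ?thesis .
  qed
  \<comment> \<open>The distribution functions of \<open>M1 i\<close> and \<open>M2 i\<close> are
    pulled back along \<open>\<phi>\<close> and corrected. Both results are increasing and upper
    semicontinuous, hence distribution functions of regular measures on the source line.\<close>
  define H1 where "H1 i x = measure (M1 i) {..\<phi> x} + D1 i x" for i x
  define H2 where "H2 i x = measure (M2 i) {..\<phi> x} + D2 i x" for i x
  have H: "mono (H1 i)" "mono (H2 i)" "usc (H1 i)" "usc (H2 i)" "0 \<le> H1 i x" "0 \<le> H2 i x" for i x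
  proof -
    show "usc (H1 i)" "usc (H2 i)" unfolding H1_def H2_def
      by (intro usc_add D usc_comp[OF usc_measure_atMost[OF reg(1)] \<phi>(1)] usc_comp[OF usc_measure_atMost[OF reg(2)] \<phi>(1)])+
    show "mono (H1 i)" "mono (H2 i)" unfolding H1_def H2_def
      using mono_measure_atMost[OF reg(1)[of i]] mono_measure_atMost[OF reg(2)[of i]] D(1,2)[of i] \<phi>(2)
      by (auto intro!: monoI add_mono dest: monoD)
    show "0 \<le> H1 i x" "0 \<le> H2 i x" unfolding H1_def H2_def using D(5,6)[of i x] by auto
  qed
  have "\<exists>N. \<forall>i. regular_finite_borel (N i) \<and> (\<forall>x. measure (N i) {..x} = H1 i x)"
    by (rule choice, rule allI, rule exists_regular_measure_mono[OF K H(1,5,3)])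
  then obtain N1 where "\<forall>i. regular_finite_borel (N1 i) \<and> (\<forall>x. measure (N1 i) {..x} = H1 i x)" ..
  then have N1: "\<And>i. regular_finite_borel (N1 i)" "\<And>i x. measure (N1 i) {..x} = H1 i x" by simp_all
  have "\<exists>N. \<forall>i. regular_finite_borel (N i) \<and> (\<forall>x. measure (N i) {..x} = H2 i x)"
    by (rule choice, rule allI, rule exists_regular_measure_mono[OF K H(2,6,4)])
  then obtain N2 where "\<forall>i. regular_finite_borel (N2 i) \<and> (\<forall>x. measure (N2 i) {..x} = H2 i x)" ..
  then have N2: "\<And>i. regular_finite_borel (N2 i)" "\<And>i x. measure (N2 i) {..x} = H2 i x" by simp_all
  define G where "G i x = H1 i x - H2 i x" for i x
  have G_eq: "G i = (\<lambda>x. F i (\<phi> x) + D1 i x - D2 i x)" for i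
    unfolding G_def H1_def H2_def DM(5) by auto
  have G_val: "G i x = F i (\<phi> x) + (if \<phi> x \<in> ?Q \<and> x < ?v (\<phi> x) then - b i (\<phi> x) else 0)" for i x
    unfolding G_eq using D_diff[of i x] by simp
  \<comment> \<open>Least points correspond under \<open>\<phi>\<close>, so composing with
    \<open>\<phi>\<close> leaves the initial term of the norm of \<open>F i\<close>
    unchanged.\<close>
  have "line_min \<le> ?u line_min" "?u line_min \<le> line_min"
    using line_min_le[OF K] line_min_le[OF L] fib(5)[of line_min line_min] by auto
  then have \<phi>min: "\<phi> line_min = line_min" using fib(1)[of line_min] by (metis antisym)
  have bv: "bounded_variation (G i)" "bv_norm (G i) \<le> bv_norm (F i) + 2 * k i" for i
    using bv_norm_comp_plus_mono[OF Fbv \<phi>(2) \<phi>min line_min_le[OF K] D(1,2,5,6,7,8), of i i i] sum_k[of i]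
    unfolding G_eq by auto
  have rc: "(G i \<longlongrightarrow> G i t) (at_right t)" for i t
    unfolding G_def by (intro tendsto_diff mono_usc_right_continuous H)
  have "{line_min..t} = {..t}" for t :: 'k using line_min_le[OF K] by auto
  then have N: "associated_measure (G i) (N1 i) (N2 i)" for i
    unfolding associated_measure_def by (simp add: N1 N2 G_def)
  obtain CF where CF: "\<And>i. bv_norm (F i) \<le> CF" using weak_star_null_bounded[OF L F] by blast
  obtain Ck where Ck: "\<And>i. k i \<le> Ck" using k by (auto simp: bdd_above_def)
  have GF: "G i (?v t) = F i t" for i t unfolding G_val fib(2) by simp
  have "fam_lim0 (\<lambda>i. integral\<^sup>L (N1 i) f - integral\<^sup>L (N2 i) f)" if "continuous_on UNIV f" for f :: "'k \<Rightarrow> real"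
  proof (rule weak_star_null_lift[OF K L \<phi> M null N bv(1) _ GF _ ab(2) that])
    show "bv_norm (G i) \<le> CF + 2 * Ck" for i using bv(2)[of i] CF[of i] Ck[of i] by linarith
    fix i t x assume t: "t \<in> ?Q" "?u t \<le> x" "x < ?v t"
    then have "\<phi> x = t" using fib(3) by simp
    then show "G i x = a i t" using t ab(1)[OF t(1)] unfolding G_val by simp
  qed
  then have "weak_star_null_NBV G"
    unfolding weak_star_null_NBV_def NBV_def using rc bv(1) N by blast
  moreover have "phi_star \<phi> (G i) = F i" for i
    using GF unfolding phi_star_def fibre_max_def by auto
  ultimately show ?thesis using bv(2) by blast
qed

theorem theorem2p7:
  fixes \<phi> :: "'k::linorder_topology \<Rightarrow> 'l::linorder_topology"
    and F :: "'i \<Rightarrow> 'l \<Rightarrow> real"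
  assumes "compact_line TYPE('k)" and "compact_line TYPE('l)"
    and "continuous_on UNIV \<phi>" and "mono \<phi>" and "surj \<phi>"
    and "weak_star_null_NBV F"
  shows "(extends_through \<phi> F \<longleftrightarrow> c0l1_over (Qset \<phi>) F) \<and>
    (\<forall>k :: 'i \<Rightarrow> real. (\<forall>i. 0 \<le> k i) \<and> bdd_above (range k) \<and> c0l1_bounded_over (Qset \<phi>) F k \<longrightarrow>
       (\<exists>G :: 'i \<Rightarrow> 'k \<Rightarrow> real. weak_star_null_NBV G \<and> (\<forall>i. phi_star \<phi> (G i) = F i) \<and>
          (\<forall>i. bv_norm (G i) \<le> bv_norm (F i) + 2 * k i)))"
proof -
  have K: "compact (UNIV :: 'k set)" and L: "compact (UNIV :: 'l set)"
    using assms(1,2) by (auto simp: compact_line_def)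
  note ext = exists_extension[OF K L assms(3-6)]
  have "c0l1_over (Qset \<phi>) F" if "extends_through \<phi> F"
    using that c0l1_over_of_extends_through[OF K assms(3-5)] unfolding extends_through_def by blast
  moreover have "extends_through \<phi> F" if c: "c0l1_over (Qset \<phi>) F"
  proof -
    obtain C where "c0l1_bounded_over (Qset \<phi>) F (\<lambda>_. C)" using c unfolding c0l1_over_def by blast
    from ext[OF _ this] show ?thesis unfolding extends_through_def by auto
  qed
  ultimately show ?thesis using ext by blast
qed

end
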